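(* The projective realisation space of $E_{33}$ satisfies $$\dim(\mathcal{R}_{proj}(E_{33}))\ge 9.$$
   Context: For a $d$-polytope $P$ with $n$ vertices, the realisation space $\mathcal{R}(P)$ is the space of all sets of $n$ points in $\mathbb{R}^d$ whose convex hull is combinatorially equivalent to $P$ (has face lattice isomorphic to that of $P$); it is a subset of $\mathbb{R}^{d\cdot n}$. The projective realisation space $\mathcal{R}_{proj}(P)$ is the quotient space of $\mathcal{R}(P)$ in which two realisations are equivalent if there is a projective transformation mapping one onto the other. $E_{33}$ is the combinatorial type of the $4$-polytope $E(C_3\times C_3)$, where for a $d$-polytope $P$, $E(P)$ is obtained combinatorially from the boundary of $P$ by stellarly subdividing every facet and then merging the two facets of the subdivision that share a ridge (face of dimension $d-2$) of $P$. Explicitly, with $i,j\in\mathbb{Z}/3$, its $15$ vertices are $v_{ij}$, $v'_i$, $v''_j$, and its facets have vertex sets $\{v_{ij},v_{i+1,j},v_{i,j+1},v_{i+1,j+1},v'_i,v''_j\}$, $\{v_{i0},v_{i1},v_{i2},v'_{i-1},v'_i\}$ and $\{v_{0j},v_{1j},v_{2j},v''_{j-1},v''_j\}$. *)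

theory Defs
  imports "HOL-Analysis.Analysis"
begin

section \<open>Quotient topologies\<close>

definition quotient_topology :: "'a topology \<Rightarrow> ('a \<times> 'a) set \<Rightarrow> 'a set topology" where
  "quotient_topology X r =
     topology (\<lambda>U. U \<subseteq> topspace X // r \<and> openin X {x \<in> topspace X. r `` {x} \<in> U})"

lemma openin_quotient_topology:
  "openin (quotient_topology X r) U \<longleftrightarrow>
     U \<subseteq> topspace X // r \<and> openin X {x \<in> topspace X. r `` {x} \<in> U}"
proof -
  have "istopology (\<lambda>U. U \<subseteq> topspace X // r \<and> openin X {x \<in> topspace X. r `` {x} \<in> U})"
    unfolding istopology_def
  proof (intro conjI allI impI)
    fix S T
    assume S: "S \<subseteq> topspace X // r \<and> openin X {x \<in> topspace X. r `` {x} \<in> S}"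
      and T: "T \<subseteq> topspace X // r \<and> openin X {x \<in> topspace X. r `` {x} \<in> T}"
    then show "S \<inter> T \<subseteq> topspace X // r"
      by blast
    have "{x \<in> topspace X. r `` {x} \<in> S \<inter> T} =
        {x \<in> topspace X. r `` {x} \<in> S} \<inter> {x \<in> topspace X. r `` {x} \<in> T}"
      by blast
    then show "openin X {x \<in> topspace X. r `` {x} \<in> S \<inter> T}"
      using S T by auto
  next
    fix \<K>
    assume K: "\<forall>K\<in>\<K>. K \<subseteq> topspace X // r \<and> openin X {x \<in> topspace X. r `` {x} \<in> K}"
    then show "\<Union>\<K> \<subseteq> topspace X // r"
      by blast
    have "{x \<in> topspace X. r `` {x} \<in> \<Union>\<K>} =
        \<Union> ((\<lambda>K. {x \<in> topspace X. r `` {x} \<in> K}) ` \<K>)"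
      by blast
    then show "openin X {x \<in> topspace X. r `` {x} \<in> \<Union>\<K>}"
      using K by auto
  qed
  then show ?thesis
    by (simp add: quotient_topology_def)
qed

lemma topspace_quotient_topology: "topspace (quotient_topology X r) = topspace X // r"
proof -
  have "{x \<in> topspace X. r `` {x} \<in> topspace X // r} = topspace X"
    by (auto simp: quotient_def)
  then have "openin (quotient_topology X r) (topspace X // r)"
    by (simp add: openin_quotient_topology)
  then show ?thesis
    by (metis openin_quotient_topology openin_subset openin_topspace subset_antisym)
qed

lemma quotient_map_quotient_topology:
  "quotient_map X (quotient_topology X r) (\<lambda>x. r `` {x})"
  by (auto simp: quotient_map_def topspace_quotient_topology openin_quotient_topology quotient_def)

section \<open>Realisation spaces\<close>

definition face_lattice :: "'a::real_vector set \<Rightarrow> 'a set set" where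
  "face_lattice P = {F. F face_of P}"

text \<open>Isomorphism of two families of sets that are both ordered by inclusion.\<close>

definition lattice_isomorphic :: "'a set set \<Rightarrow> 'b set set \<Rightarrow> bool" where
  "lattice_isomorphic \<A> \<B> \<longleftrightarrow>
     (\<exists>\<phi>. bij_betw \<phi> \<A> \<B> \<and> (\<forall>F\<in>\<A>. \<forall>G\<in>\<A>. F \<subseteq> G \<longleftrightarrow> \<phi> F \<subseteq> \<phi> G))"

text \<open>A combinatorial type is given by a face lattice \<open>\<L>\<close>. A realisation is a family of
  \<open>n\<close> points in \<open>d\<close>-space, where \<open>n\<close> (the size of the index type) is meant to be the number of
  atoms of \<open>\<L>\<close>; then the points are automatically distinct and are the vertices of their
  convex hull. The isomorphism is not required to respect any labelling of the points.\<close>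

definition realisation_space :: "'b set set \<Rightarrow> (real ^ 'd ^ 'n) set" where
  "realisation_space \<L> =
     {x. lattice_isomorphic (face_lattice (convex hull (range (\<lambda>k. x $ k)))) \<L>}"

text \<open>A projective transformation is induced by a linear automorphism \<open>L\<close> of homogeneous
  coordinates, a point \<open>p\<close> being represented by \<open>(p, 1)\<close>. It is a map on \<open>P\<close> if no point of \<open>P\<close>
  is sent to infinity.\<close>

definition projective_map :: "('a::real_vector \<times> real \<Rightarrow> 'a \<times> real) \<Rightarrow> 'a \<Rightarrow> 'a" where
  "projective_map L p = fst (L (p, 1)) /\<^sub>R snd (L (p, 1))"

definition projectively_equivalent :: "'a::real_vector set \<Rightarrow> 'a set \<Rightarrow> bool" where
  "projectively_equivalent P Q \<longleftrightarrow>
     (\<exists>L. linear L \<and> bij L \<and> (\<forall>p\<in>P. snd (L (p, 1)) \<noteq> 0) \<and> projective_map L ` P = Q)"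

lemma projectively_equivalent_refl: "projectively_equivalent P P"
  unfolding projectively_equivalent_def projective_map_def
  by (rule exI[of _ "\<lambda>z. z"]) (auto simp: linear_ident bij_def)

lemma linear_projective_map:
  assumes "linear L" "snd (L (p, 1)) \<noteq> 0"
  shows "L (p, 1) = snd (L (p, 1)) *\<^sub>R (projective_map L p, 1)"
  using assms by (simp add: projective_map_def prod_eq_iff)

lemma projectively_equivalent_sym:
  assumes "projectively_equivalent P Q"
  shows "projectively_equivalent Q P"
proof -
  obtain L where L: "linear L" "bij L" and nz: "\<And>p. p \<in> P \<Longrightarrow> snd (L (p, 1)) \<noteq> 0"
    and Q: "Q = projective_map L ` P"
    using assms by (auto simp: projectively_equivalent_def)
  define M where "M = inv L"
  have inv_eq: "M (L z) = z" and inv_eq': "L (M z) = z" for z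
    using L(2) by (simp_all add: M_def bij_is_inj bij_is_surj surj_f_inv_f)
  have M: "bij M" "linear M"
  proof -
    show "bij M"
      using L(2) by (simp add: M_def bij_imp_bij_inv)
    show "linear M"
    proof (rule linearI)
      show "M (u + v) = M u + M v" for u v
        by (metis inv_eq inv_eq' linear_add[OF L(1)])
      show "M (c *\<^sub>R u) = c *\<^sub>R M u" for c u
        by (metis inv_eq inv_eq' linear_cmul[OF L(1)])
    qed
  qed
  have key: "M (projective_map L p, 1) = (1 / snd (L (p, 1))) *\<^sub>R (p, 1)" if "p \<in> P" for p
  proof -
    have "(projective_map L p, 1) = (1 / snd (L (p, 1))) *\<^sub>R L (p, 1)"
      using nz[OF that] by (simp add: projective_map_def prod_eq_iff divide_inverse)
    then show ?thesis
      by (simp only: linear_cmul[OF M(2)] inv_eq)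
  qed
  have inv: "projective_map M (projective_map L p) = p" if "p \<in> P" for p
    unfolding projective_map_def[of M] using key[OF that] nz[OF that] by simp
  have "\<forall>q\<in>Q. snd (M (q, 1)) \<noteq> 0"
    using key nz by (auto simp: Q)
  moreover have "projective_map M ` Q = P"
    using inv by (force simp: Q image_image)
  ultimately show ?thesis
    using M by (auto simp: projectively_equivalent_def)
qed

lemma projectively_equivalent_trans:
  assumes "projectively_equivalent P Q" "projectively_equivalent Q R"
  shows "projectively_equivalent P R"
proof -
  obtain L where L: "linear L" "bij L" and nzL: "\<And>p. p \<in> P \<Longrightarrow> snd (L (p, 1)) \<noteq> 0"
    and Q: "Q = projective_map L ` P"
    using assms(1) by (auto simp: projectively_equivalent_def)
  obtain M where M: "linear M" "bij M" and nzM: "\<And>q. q \<in> Q \<Longrightarrow> snd (M (q, 1)) \<noteq> 0"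
    and R: "R = projective_map M ` Q"
    using assms(2) by (auto simp: projectively_equivalent_def)
  have key: "M (L (p, 1)) = snd (L (p, 1)) *\<^sub>R M (projective_map L p, 1)" if "p \<in> P" for p
    by (subst linear_projective_map[OF L(1) nzL[OF that]]) (rule linear_cmul[OF M(1)])
  have nz: "snd ((M \<circ> L) (p, 1)) \<noteq> 0" if "p \<in> P" for p
    using key[OF that] nzL[OF that] nzM that by (auto simp: Q)
  have "projective_map (M \<circ> L) p = projective_map M (projective_map L p)" if "p \<in> P" for p
    unfolding projective_map_def[of "M \<circ> L"] projective_map_def[of M]
    using key[OF that] nzL[OF that] by simp
  then have "projective_map (M \<circ> L) ` P = R"
    by (simp add: R Q image_image)
  moreover have "linear (M \<circ> L)" "bij (M \<circ> L)"
    using L M by (auto simp: linear_compose bij_comp)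
  ultimately show ?thesis
    using nz unfolding projectively_equivalent_def by blast
qed

text \<open>Realisations are compared as unlabelled polytopes: the projective transformation maps the
  one convex hull, hence the one vertex set, onto the other.\<close>

definition projective_equivalence :: "'b set set \<Rightarrow> ((real ^ 'd ^ 'n) \<times> (real ^ 'd ^ 'n)) set" where
  "projective_equivalence \<L> =
     {(x, y). x \<in> realisation_space \<L> \<and> y \<in> realisation_space \<L> \<and>
        projectively_equivalent (convex hull (range (\<lambda>k. x $ k)))
          (convex hull (range (\<lambda>k. y $ k)))}"

lemma equiv_projective_equivalence:
  "equiv (realisation_space \<L>) (projective_equivalence \<L>)"
  by (intro equivI refl_onI symI transI)
    (auto simp: projective_equivalence_def projectively_equivalent_refl
      intro: projectively_equivalent_sym projectively_equivalent_trans)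

definition projective_realisation_space :: "'b set set \<Rightarrow> (real ^ 'd ^ 'n) set topology" where
  "projective_realisation_space \<L> =
     quotient_topology (top_of_set (realisation_space \<L>)) (projective_equivalence \<L>)"

section \<open>The combinatorial type \<open>E\<^sub>3\<^sub>3\<close>\<close>

text \<open>\<open>V i j\<close>, \<open>V1 i\<close>, \<open>V2 j\<close> stand for $v_{ij}$, $v'_i$, $v''_j$. Indices have the
  numeral type \<open>3\<close>, whose arithmetic is modulo 3.\<close>

datatype E33_vertex = V 3 3 | V1 3 | V2 3

definition E33_facets :: "E33_vertex set set" where
  "E33_facets =
     {{V i j, V (i + 1) j, V i (j + 1), V (i + 1) (j + 1), V1 i, V2 j} | i j. True}
     \<union> {{V i 0, V i 1, V i 2, V1 (i - 1), V1 i} | i. True}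
     \<union> {{V 0 j, V 1 j, V 2 j, V2 (j - 1), V2 j} | j. True}"

text \<open>The faces of a polytope are the intersections of its facets, the empty intersection being
  the polytope itself.\<close>

definition E33_face_lattice :: "E33_vertex set set" where
  "E33_face_lattice = {\<Inter>\<F> | \<F>. \<F> \<subseteq> E33_facets}"

end

theory Submission
  imports Defs
begin

text \<open>Nine parameters are visible on the realisations in which the \<open>v\<^sub>i\<^sub>j\<close> form a product of two
  fixed triangles in \<open>\<real>\<^sup>2 \<times> \<real>\<^sup>2\<close>. The bipyramids force the first components of the \<open>v'\<^sub>i\<close> to form a
  triangle circumscribed about the first triangle (3 parameters), and likewise for the \<open>v''\<^sub>j\<close>; the
  other components are free (12 parameters), and each of the nine octahedra imposes one
  equation. A projective transformation between two such realisations that respects the labels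
  is the identity, since it fixes the \<open>v\<^sub>i\<^sub>j\<close>.

  To pass to unlabelled realisations and to the quotient topology, note that a limit of
  projective equivalences between realisations is again one (the weights of the \<open>v\<^sub>i\<^sub>j\<close> satisfy square
  relations, which forbid that some vanish in the limit). Hence the relabellings that identify
  two members of the family close to a point \<open>d\<close> are among those that identify \<open>d\<close> with itself; where the
  number of the latter is minimal, they identify every nearby member with itself, and by
  rigidity two distinct nearby members are never identified. So a 9-dimensional ball
  embeds into the projective realisation space. Finally, a ball in \<open>\<real>\<^sup>n\<close> has small inductive
  dimension at least \<open>n\<close>: on a compact set of dimension below \<open>n\<close>, \<open>n\<close> functions without a common zero
  on a closed subset extend without a common zero, whereas the sphere is no retract of the ball.\<close>

section \<open>Small inductive dimension of a ball\<close>

text \<open>Up to normalisation, this is extendability of maps into the sphere of dimension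
  \<open>m - 1\<close>, which characterises covering dimension at most \<open>m - 1\<close> of
  compact sets. Families indexed by naturals let \<open>m\<close> vary in an induction. For
  \<open>m = 0\<close> the property says that \<open>K\<close> is empty.\<close>

definition zero_free_extension :: "nat \<Rightarrow> 'a::euclidean_space set \<Rightarrow> bool" where
  "zero_free_extension m K \<longleftrightarrow>
     (\<forall>A (f :: nat \<Rightarrow> 'a \<Rightarrow> real). closed A \<and> A \<subseteq> K \<and> (\<forall>i<m. continuous_on A (f i)) \<and>
        (\<forall>x\<in>A. \<exists>i<m. f i x \<noteq> 0) \<longrightarrow>
        (\<exists>g. (\<forall>i<m. continuous_on K (g i)) \<and> (\<forall>x\<in>K. \<exists>i<m. g i x \<noteq> 0) \<and>
           (\<forall>i<m. \<forall>x\<in>A. g i x = f i x)))"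

lemma zero_free_extensionE:
  fixes f :: "nat \<Rightarrow> 'a::euclidean_space \<Rightarrow> real"
  assumes "zero_free_extension m K" "closed A" "A \<subseteq> K"
    and "\<And>i. i < m \<Longrightarrow> continuous_on A (f i)" "\<And>x. x \<in> A \<Longrightarrow> \<exists>i<m. f i x \<noteq> 0"
  obtains g where "\<And>i. i < m \<Longrightarrow> continuous_on K (g i)" "\<And>x. x \<in> K \<Longrightarrow> \<exists>i<m. g i x \<noteq> 0"
    "\<And>i x. i < m \<Longrightarrow> x \<in> A \<Longrightarrow> g i x = f i x"
proof -
  have "\<exists>g. (\<forall>i<m. continuous_on K (g i)) \<and> (\<forall>x\<in>K. \<exists>i<m. g i x \<noteq> 0) \<and>
           (\<forall>i<m. \<forall>x\<in>A. g i x = f i x)"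
    using assms(1)[unfolded zero_free_extension_def, rule_format, of A f] assms(2-) by blast
  then show ?thesis
    using that by blast
qed

lemma Tietze_family:
  fixes f :: "nat \<Rightarrow> 'a::euclidean_space \<Rightarrow> real"
  assumes "closed A" "A \<subseteq> K" "\<And>i. i < m \<Longrightarrow> continuous_on A (f i)"
  obtains g where "\<And>i. i < m \<Longrightarrow> continuous_on K (g i)" "\<And>i x. i < m \<Longrightarrow> x \<in> A \<Longrightarrow> g i x = f i x"
proof -
  have cl: "closedin (top_of_set K) A"
    using assms(1,2) closed_subset by blast
  have "\<exists>g. continuous_on K g \<and> (\<forall>x\<in>A. g x = f i x)" if "i < m" for i
    by (rule Dugundji[of "UNIV::real set" K A "f i"]) (use cl assms(3)[OF that] in auto)
  then obtain g where "\<forall>i<m. continuous_on K (g i) \<and> (\<forall>x\<in>A. g i x = f i x)"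
    by metis
  then show ?thesis
    using that by blast
qed

lemma zero_free_extension_subset:
  assumes "zero_free_extension m K" "K' \<subseteq> K"
  shows "zero_free_extension m K'"
  unfolding zero_free_extension_def
proof (intro allI impI, elim conjE)
  fix A and f :: "nat \<Rightarrow> 'a \<Rightarrow> real"
  assume A: "closed A" "A \<subseteq> K'" "\<forall>i<m. continuous_on A (f i)" "\<forall>x\<in>A. \<exists>i<m. f i x \<noteq> 0"
  obtain g where "\<And>i. i < m \<Longrightarrow> continuous_on K (g i)" "\<And>x. x \<in> K \<Longrightarrow> \<exists>i<m. g i x \<noteq> 0"
    "\<And>i x. i < m \<Longrightarrow> x \<in> A \<Longrightarrow> g i x = f i x"
    by (rule zero_free_extensionE[OF assms(1), of A f]) (use A assms(2) in auto)
  then show "\<exists>g. (\<forall>i<m. continuous_on K' (g i)) \<and> (\<forall>x\<in>K'. \<exists>i<m. g i x \<noteq> 0) \<and>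
           (\<forall>i<m. \<forall>x\<in>A. g i x = f i x)"
    using assms(2) by (intro exI[of _ g]) (meson continuous_on_subset subsetD)
qed

text \<open>Extend over \<open>B\<close> first, paste with \<open>f\<close> on \<open>A\<close>,
  then extend the pasted functions over \<open>C\<close> from the part of their domain inside
  \<open>C\<close>.\<close>

lemma zero_free_extension_Un:
  assumes B: "closed B" "zero_free_extension m B" and C: "closed C" "zero_free_extension m C"
  shows "zero_free_extension m (B \<union> C)"
  unfolding zero_free_extension_def
proof (intro allI impI, elim conjE)
  fix A and f :: "nat \<Rightarrow> 'a \<Rightarrow> real"
  assume A: "closed A" "A \<subseteq> B \<union> C" "\<forall>i<m. continuous_on A (f i)" "\<forall>x\<in>A. \<exists>i<m. f i x \<noteq> 0"
  obtain g where g: "\<And>i. i < m \<Longrightarrow> continuous_on B (g i)" "\<And>x. x \<in> B \<Longrightarrow> \<exists>i<m. g i x \<noteq> 0"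
    "\<And>i x. i < m \<Longrightarrow> x \<in> A \<inter> B \<Longrightarrow> g i x = f i x"
    by (rule zero_free_extensionE[OF B(2), of "A \<inter> B" f])
      (use A B(1) in \<open>auto intro: continuous_on_subset\<close>)
  define f1 where "f1 i x = (if x \<in> B then g i x else f i x)" for i x
  have f1: "continuous_on (B \<union> A) (f1 i)" if "i < m" for i
    unfolding f1_def using g A(1,3) B(1) that by (intro continuous_on_If) auto
  have f1nz: "\<exists>i<m. f1 i x \<noteq> 0" if "x \<in> B \<union> A" for x
    using that g(2) A(4) by (auto simp: f1_def)
  obtain h where h: "\<And>i. i < m \<Longrightarrow> continuous_on C (h i)" "\<And>x. x \<in> C \<Longrightarrow> \<exists>i<m. h i x \<noteq> 0"
    "\<And>i x. i < m \<Longrightarrow> x \<in> (B \<union> A) \<inter> C \<Longrightarrow> h i x = f1 i x"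
    by (rule zero_free_extensionE[OF C(2), of "(B \<union> A) \<inter> C" f1])
      (use A(1) B(1) C(1) f1nz in \<open>auto intro: continuous_on_subset[OF f1]\<close>)
  define k where "k i x = (if x \<in> B then g i x else h i x)" for i x
  show "\<exists>g. (\<forall>i<m. continuous_on (B \<union> C) (g i)) \<and> (\<forall>x\<in>B \<union> C. \<exists>i<m. g i x \<noteq> 0) \<and>
           (\<forall>i<m. \<forall>x\<in>A. g i x = f i x)"
  proof (intro exI[of _ k] conjI allI impI ballI)
    show "continuous_on (B \<union> C) (k i)" if "i < m" for i
      unfolding k_def using g(1) h(1,3) B(1) C(1) that
      by (intro continuous_on_If) (auto simp: f1_def)
    show "\<exists>i<m. k i x \<noteq> 0" if "x \<in> B \<union> C" for x
      using that g(2) h(2) by (auto simp: k_def)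
    show "k i x = f i x" if "i < m" "x \<in> A" for i x
      using that g(3)[of i x] h(3)[of i x] A(2) by (auto simp: k_def f1_def)
  qed
qed

lemma zero_free_extension_Union:
  assumes "finite \<B>" "\<And>B. B \<in> \<B> \<Longrightarrow> closed B \<and> zero_free_extension m B"
  shows "zero_free_extension m (\<Union>\<B>)"
  using assms
proof (induction \<B>)
  case empty
  then show ?case
    by (auto simp: zero_free_extension_def)
next
  case (insert B \<B>)
  then have "zero_free_extension m (B \<union> \<Union>\<B>)"
    by (intro zero_free_extension_Un) auto
  then show ?case
    by simp
qed


text \<open>By homotopy extension: the \<open>m + 1\<close> functions are deformed until the last one is negative.
  First the others are made zero-free where the last one is nonnegative, using the
  hypothesis on \<open>B\<close>; then the last one is lowered.\<close>

lemma zero_free_extension_Suc: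
  fixes f :: "nat \<Rightarrow> 'a::euclidean_space \<Rightarrow> real"
  assumes K: "compact K" and B: "closed B" "B \<subseteq> K" "zero_free_extension m B"
    and f: "\<And>i. i < Suc m \<Longrightarrow> continuous_on B (f i)" "\<And>x. x \<in> B \<Longrightarrow> \<exists>i<Suc m. f i x \<noteq> 0"
  obtains g where "\<And>i. i < Suc m \<Longrightarrow> continuous_on K (g i)" "\<And>x. x \<in> K \<Longrightarrow> \<exists>i<Suc m. g i x \<noteq> 0"
    "\<And>i x. i < Suc m \<Longrightarrow> x \<in> B \<Longrightarrow> g i x = f i x"
proof -
  define Bp where "Bp = {x \<in> B. 0 \<le> f m x}"
  define Bn where "Bn = {x \<in> B. f m x \<le> 0}"
  have cf: "continuous_on B (f m)"
    using f(1) by simp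
  have Bp: "closed Bp" and Bn: "closed Bn"
    unfolding Bp_def Bn_def using continuous_on_closed_Collect_le B(1) cf continuous_on_const
    by blast+
  \<comment> \<open>On \<open>Bp \<inter> Bn\<close> the last function vanishes, so the other
    \<open>m\<close> have no common zero there and extend over \<open>Bp\<close> without
    one.\<close>
  have "zero_free_extension m Bp"
    using B(3) by (rule zero_free_extension_subset) (auto simp: Bp_def)
  then obtain h where h: "\<And>i. i < m \<Longrightarrow> continuous_on Bp (h i)" "\<And>x. x \<in> Bp \<Longrightarrow> \<exists>i<m. h i x \<noteq> 0"
    "\<And>i x. i < m \<Longrightarrow> x \<in> Bp \<inter> Bn \<Longrightarrow> h i x = f i x"
  proof (rule zero_free_extensionE[of m Bp "Bp \<inter> Bn" f])
    show "continuous_on (Bp \<inter> Bn) (f i)" if "i < m" for i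
      by (rule continuous_on_subset[OF f(1)[of i]]) (use that in \<open>auto simp: Bp_def\<close>)
    show "\<exists>i<m. f i x \<noteq> 0" if "x \<in> Bp \<inter> Bn" for x
      using f(2)[of x] that by (auto simp: Bp_def Bn_def less_Suc_eq)
  qed (use Bp Bn in auto)
  define k where "k i x = (if 0 \<le> f m x then h i x else f i x)" for i x
  have BpBn: "Bp \<union> Bn = B"
    by (auto simp: Bp_def Bn_def)
  have ck: "continuous_on B (k i)" if "i < m" for i
  proof -
    have "continuous_on (Bp \<union> Bn) (k i)"
      unfolding k_def
    proof (rule continuous_on_If)
      show "continuous_on Bn (f i)"
        by (rule continuous_on_subset[OF f(1)]) (use that in \<open>auto simp: Bn_def\<close>)
    qed (use Bp Bn h that in \<open>auto simp: Bp_def Bn_def\<close>)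
    then show ?thesis
      by (simp add: BpBn)
  qed
  obtain F where F: "\<And>i. i < Suc m \<Longrightarrow> continuous_on K (F i)" "\<And>i x. i < Suc m \<Longrightarrow> x \<in> B \<Longrightarrow> F i x = f i x"
    using Tietze_family[OF B(1,2), of "Suc m" f] f(1) by blast
  obtain k' where k': "\<And>i. i < m \<Longrightarrow> continuous_on K (k' i)" "\<And>i x. i < m \<Longrightarrow> x \<in> B \<Longrightarrow> k' i x = k i x"
    using Tietze_family[OF B(1,2), of m k] ck by blast
  have "bounded (F m ` K)"
    using F(1) K by (simp add: compact_continuous_image compact_imp_bounded)
  then obtain C where C: "0 < C" "\<And>x. x \<in> K \<Longrightarrow> F m x < C"
    by (metis (no_types) bounded_pos_less abs_less_iff image_eqI real_norm_def)
  \<comment> \<open>The time \<open>snd z\<close> runs through \<open>{0..2}\<close>: up to time 1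
    the first \<open>m\<close> functions move from \<open>F\<close> to \<open>k'\<close>, then the
    last one sinks by \<open>C\<close> in total. As \<open>C\<close> exceeds \<open>F m\<close> on
    \<open>K\<close>, it is negative at time 2.\<close>
  define H where "H i z = (if i < m then (1 - min (snd z) 1) * F i (fst z) + min (snd z) 1 * k' i (fst z)
     else F m (fst z) - max 0 (snd z - 1) * C)" for i :: nat and z :: "'a \<times> real"
  have cH: "continuous_on (K \<times> {0..2}) (H i)" if "i < Suc m" for i
  proof (cases "i < m")
    case True
    have "continuous_on (K \<times> {0..2::real}) (\<lambda>z. F i (fst z))" "continuous_on (K \<times> {0..2::real}) (\<lambda>z. k' i (fst z))"
      using F(1)[of i] k'(1)[of i] True
      by (auto intro!: continuous_on_compose2[where f=fst] continuous_intros)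
    then show ?thesis
      unfolding H_def using True by (auto intro!: continuous_intros)
  next
    case False
    have "continuous_on (K \<times> {0..2::real}) (\<lambda>z. F m (fst z))"
      using F(1)[of m] by (auto intro!: continuous_on_compose2[where f=fst] continuous_intros)
    then show ?thesis
      unfolding H_def using False by (auto intro!: continuous_intros)
  qed
  \<comment> \<open>No common zero ever appears over \<open>B\<close>. Up to time 1, either
    \<open>f m x\<close> is nonzero, or \<open>h\<close> agrees with \<open>f\<close> and nothing
    moves. Later, the first \<open>m\<close> functions have no common zero where
    \<open>f m x\<close> is nonnegative, and elsewhere the last one is negative and only
    sinks.\<close>
  have Hnz: "\<exists>i<Suc m. H i (x, s) \<noteq> 0" if xB: "x \<in> B" and s0: "0 \<le> s" for x s
  proof (cases "s \<le> 1")
    case True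
    show ?thesis
    proof (cases "f m x = 0")
      case True
      then have "x \<in> Bp \<inter> Bn"
        using that by (auto simp: Bp_def Bn_def)
      then have "k' i x = f i x" if "i < m" for i
        using k'(2)[OF that \<open>x \<in> B\<close>] h(3)[OF that] by (simp add: k_def)
      moreover obtain i where "i < m" "f i x \<noteq> 0"
        using f(2)[OF \<open>x \<in> B\<close>] True by (auto simp: less_Suc_eq)
      ultimately have "H i (x, s) = f i x"
        using F(2)[of i x] that by (simp add: H_def algebra_simps)
      then show ?thesis
        using \<open>i < m\<close> \<open>f i x \<noteq> 0\<close> less_SucI by metis
    next
      case False
      then show ?thesis
        using \<open>s \<le> 1\<close> F(2)[of m x] that by (intro exI[of _ m]) (auto simp: H_def)
    qed
  next
    case False
    show ?thesis
    proof (cases "0 \<le> f m x")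
      case True
      then obtain i where i: "i < m" "h i x \<noteq> 0"
        using h(2)[of x] xB by (auto simp: Bp_def)
      then have "H i (x, s) = h i x"
        using k'(2)[of i x] that False True by (simp add: H_def k_def)
      then show ?thesis
        using i by (metis less_SucI)
    next
      case f: False
      have "f m x < C * max 0 (s - 1)"
      proof -
        have "0 \<le> C * max 0 (s - 1)"
          using C(1) by simp
        with f show ?thesis
          by linarith
      qed
      then show ?thesis
        using F(2)[of m x] that by (intro exI[of _ m]) (auto simp: H_def mult.commute)
    qed
  qed
  \<comment> \<open>\<open>Z\<close> collects the points with a common zero at some time. A Urysohn
    function sends \<open>B\<close> to time 0, where \<open>f\<close> is kept, and \<open>Z\<close>
    to time 2, where the last function is negative.\<close>
  define Z where "Z = fst ` {z \<in> K \<times> {0..2}. \<forall>i<Suc m. H i z = 0}"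
  have "compact Z"
  proof -
    have "{z \<in> K \<times> {0..2}. \<forall>i<Suc m. H i z = 0} = K \<times> {0..2} \<inter> (\<lambda>z. \<Sum>i<Suc m. \<bar>H i z\<bar>) -` {0}"
      by (auto simp: sum_nonneg_eq_0_iff simp del: sum.lessThan_Suc)
    moreover have "continuous_on (K \<times> {0..2}) (\<lambda>z. \<Sum>i<Suc m. \<bar>H i z\<bar>)"
      by (intro continuous_intros cH) simp
    moreover have "compact (K \<times> {0..2::real})"
      using K by (simp add: compact_Times)
    ultimately have "compact {z \<in> K \<times> {0..2}. \<forall>i<Suc m. H i z = 0}"
      using continuous_closed_preimage[of "K \<times> {0..2}" "\<lambda>z. \<Sum>i<Suc m. \<bar>H i z\<bar>" "{0}"]
        compact_Int_closed[of "K \<times> {0..2}" "K \<times> {0..2} \<inter> (\<lambda>z. \<Sum>i<Suc m. \<bar>H i z\<bar>) -` {0}"]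
        compact_imp_closed[of "K \<times> {0..2::real}"]
      by (simp add: Int_assoc[symmetric] del: sum.lessThan_Suc)
    then show ?thesis
      unfolding Z_def by (intro compact_continuous_image continuous_intros)
  qed
  moreover have "Z \<inter> B = {}"
    using Hnz by (fastforce simp: Z_def)
  ultimately obtain \<sigma> :: "'a \<Rightarrow> real" where \<sigma>: "continuous_on UNIV \<sigma>" "\<And>x. \<sigma> x \<in> closed_segment 0 2"
    "\<And>x. x \<in> B \<Longrightarrow> \<sigma> x = 0" "\<And>x. x \<in> Z \<Longrightarrow> \<sigma> x = 2"
    using Urysohn[of B Z "0::real" 2] B(1) by (metis Int_commute compact_imp_closed)
  have \<sigma>01: "0 \<le> \<sigma> x" "\<sigma> x \<le> 2" for x
    using \<sigma>(2)[of x] by (auto simp: closed_segment_eq_real_ivl)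
  show ?thesis
  proof (rule that[of "\<lambda>i x. H i (x, \<sigma> x)"])
    show "continuous_on K (\<lambda>x. H i (x, \<sigma> x))" if "i < Suc m" for i
      by (rule continuous_on_compose2[OF cH[OF that]])
        (use \<sigma>01 \<sigma>(1) in \<open>auto intro!: continuous_intros intro: continuous_on_subset\<close>)
    show "\<exists>i<Suc m. H i (x, \<sigma> x) \<noteq> 0" if "x \<in> K" for x
    proof (cases "x \<in> Z")
      case True
      then show ?thesis
        using \<sigma>(4) C(2)[OF that] by (intro exI[of _ m]) (auto simp: H_def)
    next
      case False
      then have "(x, \<sigma> x) \<notin> {z \<in> K \<times> {0..2}. \<forall>i<Suc m. H i z = 0}"
        unfolding Z_def by force
      then show ?thesis
        using that \<sigma>01 by auto
    qed
    show "H i (x, \<sigma> x) = f i x" if "i < Suc m" "x \<in> B" for i x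
      using that \<sigma>(3) F(2)[of i x] F(2)[of m x] by (cases "i = m") (auto simp: H_def less_Suc_eq)
  qed
qed

text \<open>A Tietze extension \<open>F\<close> may acquire common zeros away from \<open>A\<close>.
  Finitely many open sets with boundaries of smaller dimension cover \<open>A\<close>, and
  \<open>F\<close> is still free of common zeros on the closure of their union \<open>V\<close>. By
  induction the boundary of \<open>V\<close> has the property for \<open>m\<close>, so
  \<open>zero_free_extension_Suc\<close> yields functions that replace \<open>F\<close> outside
  \<open>V\<close>.\<close>

lemma compact_dimension_le_zero_free_extension:
  fixes K :: "'a::euclidean_space set"
  assumes "compact K" "top_of_set K dim_le int m - 1"
  shows "zero_free_extension m K"
  using assms
proof (induction m arbitrary: K)
  case 0
  then have "K = {}"
    by (metis dimension_le_eq_empty diff_0 of_nat_0 topspace_euclidean_subtopology topspace_discrete_topology null_topspace_iff_trivial)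
  then show ?case
    by (simp add: zero_free_extension_def)
next
  case (Suc m K)
  have clK: "closed K"
    using Suc.prems(1) compact_imp_closed by blast
  show ?case
    unfolding zero_free_extension_def
  proof (intro allI impI, elim conjE)
    fix A and f :: "nat \<Rightarrow> 'a \<Rightarrow> real"
    assume A: "closed A" "A \<subseteq> K" "\<forall>i<Suc m. continuous_on A (f i)" "\<forall>x\<in>A. \<exists>i<Suc m. f i x \<noteq> 0"
    then obtain F where F: "\<And>i. i < Suc m \<Longrightarrow> continuous_on K (F i)"
      "\<And>i x. i < Suc m \<Longrightarrow> x \<in> A \<Longrightarrow> F i x = f i x"
      using Tietze_family[of A K "Suc m" f] by blast
    define N where "N x = (\<Sum>i<Suc m. \<bar>F i x\<bar>)" for x
    have cN: "continuous_on K N"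
      unfolding N_def using F(1) by (auto intro!: continuous_intros)
    have Npos: "0 < N x \<longleftrightarrow> (\<exists>i<Suc m. F i x \<noteq> 0)" for x
    proof -
      have "N x = 0 \<longleftrightarrow> (\<forall>i\<in>{..<Suc m}. \<bar>F i x\<bar> = 0)" "N x \<ge> 0"
        unfolding N_def by (rule sum_nonneg_eq_0_iff) (auto intro!: sum_nonneg)
      then show ?thesis
        by (metis abs_eq_0 lessThan_iff order_less_le)
    qed
    have compA: "compact A"
      using A(1,2) Suc.prems(1) by (metis compact_Int_closed inf.absorb_iff2)
    \<comment> \<open>The margin keeps \<open>F\<close> without common zeros on the closure of
      \<open>V\<close>, not only on \<open>V\<close> itself.\<close>
    obtain \<delta> where \<delta>: "0 < \<delta>" "\<And>x. x \<in> A \<Longrightarrow> \<delta> < N x"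
    proof (cases "A = {}")
      case True
      then show ?thesis
        using that[of 1] by simp
    next
      case False
      then obtain a where a: "a \<in> A" "\<And>x. x \<in> A \<Longrightarrow> N a \<le> N x"
        using continuous_attains_inf[OF compA _ continuous_on_subset[OF cN A(2)]] by blast
      have "0 < N a"
        using A(4) F(2) a(1) Npos by metis
      then show ?thesis
        using that[of "N a / 2"] a(2) by (metis field_sum_of_halves half_gt_zero less_add_same_cancel1 order_less_le_trans)
    qed
    define W where "W = {x \<in> K. \<delta> < N x}"
    have W: "openin (top_of_set K) W"
      unfolding W_def using continuous_openin_preimage_gen[OF cN, of "{\<delta><..}"]
      by (simp add: vimage_def Int_def)
    have clW: "closed {x \<in> K. \<delta> \<le> N x}"
      using clK cN by (intro continuous_on_closed_Collect_le) auto
    have "\<exists>U. a \<in> U \<and> U \<subseteq> W \<and> openin (top_of_set K) U \<and>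
        top_of_set (closure U - U) dim_le int m - 1" if "a \<in> A" for a
    proof -
      have "a \<in> W"
        using \<delta>(2) A(2) that by (auto simp: W_def)
      \<comment> \<open>The recursion of \<open>dim_le\<close> supplies neighbourhoods whose
        boundary has dimension one less; relative to the closed set \<open>K\<close> this boundary
        is \<open>closure U - U\<close>.\<close>
      then obtain U where U: "a \<in> U" "U \<subseteq> W" "openin (top_of_set K) U"
        "subtopology (top_of_set K) (top_of_set K frontier_of U) dim_le int (Suc m) - 1 - 1"
        using Suc.prems(2)[unfolded dimension_le.simps[of "top_of_set K"]] W by blast
      have "top_of_set K frontier_of U = closure U - U"
      proof -
        have "U \<subseteq> K"
          using U(3) openin_imp_subset by blast
        then have "closure U \<subseteq> K"
          by (simp add: clK closure_minimal)
        then show ?thesis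
          using U(3) \<open>U \<subseteq> K\<close>
          by (simp add: frontier_of_def closure_of_subtopology interior_of_openin Int_absorb1)
      qed
      moreover have "closure U - U \<subseteq> K"
        using U(3) by (metis Diff_subset clK closure_minimal openin_imp_subset order_trans)
      ultimately show ?thesis
        using U by (auto simp: subtopology_subtopology Int_absorb1)
    qed
    then obtain U where U: "\<And>a. a \<in> A \<Longrightarrow> a \<in> U a" "\<And>a. a \<in> A \<Longrightarrow> U a \<subseteq> W"
      "\<And>a. a \<in> A \<Longrightarrow> openin (top_of_set K) (U a)"
      "\<And>a. a \<in> A \<Longrightarrow> top_of_set (closure (U a) - U a) dim_le int m - 1"
      by metis
    have fr: "closed (closure V - V)" "closure V \<subseteq> K" if V: "openin (top_of_set K) V" for V
    proof -
      show sub: "closure V \<subseteq> K"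
        using V by (simp add: clK closure_minimal openin_imp_subset)
      obtain T where "open T" "V = K \<inter> T"
        using V by (auto simp: openin_open)
      then have "closure V - V = closure V - T"
        using sub closure_subset by blast
      then show "closed (closure V - V)"
        using \<open>open T\<close> by (simp add: closed_Diff)
    qed
    obtain D where D: "finite D" "D \<subseteq> A" "A \<subseteq> \<Union>(U ` D)"
    proof -
      obtain T where T: "\<And>a. a \<in> A \<Longrightarrow> open (T a) \<and> U a = K \<inter> T a"
      proof -
        have "\<forall>a\<in>A. \<exists>T. open T \<and> U a = K \<inter> T"
          using U(3) by (simp add: openin_open)
        then show thesis
          using that by (auto dest!: bchoice)
      qed
      then have "A \<subseteq> (\<Union>a\<in>A. T a)"
        using U(1) by blast
      then obtain D where "D \<subseteq> A" "finite D" "A \<subseteq> (\<Union>a\<in>D. T a)"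
        using compactE_image[OF compA, of A T] T by auto
      then show ?thesis
        using that[of D] T A(2) by blast
    qed
    define V where "V = \<Union>(U ` D)"
    have V: "openin (top_of_set K) V"
      unfolding V_def using U(3) D(2) by blast
    have VW: "V \<subseteq> W"
      unfolding V_def using U(2) D(2) by blast
    define B where "B = closure V - V"
    have clV: "closure V \<subseteq> {x \<in> K. \<delta> \<le> N x}"
      using VW by (intro closure_minimal clW) (auto simp: W_def)
    have Bcl: "closed B" "B \<subseteq> K"
      unfolding B_def using fr[OF V] by auto
    have "zero_free_extension m (\<Union>((\<lambda>a. closure (U a) - U a) ` D))"
    proof (rule zero_free_extension_Union)
      fix X assume "X \<in> (\<lambda>a. closure (U a) - U a) ` D"
      then obtain a where a: "a \<in> A" "X = closure (U a) - U a"
        using D(2) by blast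
      have "closed X" "X \<subseteq> K"
        using fr[OF U(3)[OF a(1)]] a(2) by auto
      then have "compact X"
        using Suc.prems(1) by (metis compact_Int_closed inf.absorb_iff2)
      then show "closed X \<and> zero_free_extension m X"
        using Suc.IH U(4)[OF a(1)] a(2) \<open>closed X\<close> by blast
    qed (use D(1) in auto)
    moreover have "B \<subseteq> \<Union>((\<lambda>a. closure (U a) - U a) ` D)"
    proof -
      have "closure V \<subseteq> \<Union>((\<lambda>a. closure (U a)) ` D)"
        unfolding V_def using D(1) closure_subset by (intro closure_minimal closed_UN) auto
      then show ?thesis
        unfolding B_def V_def by blast
    qed
    ultimately have zB: "zero_free_extension m B"
      by (rule zero_free_extension_subset)
    have Fnz: "\<exists>i<Suc m. F i x \<noteq> 0" if "x \<in> closure V" for x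
      using clV that \<delta>(1) Npos[of x] by force
    obtain g where g: "\<And>i. i < Suc m \<Longrightarrow> continuous_on K (g i)"
      "\<And>x. x \<in> K \<Longrightarrow> \<exists>i<Suc m. g i x \<noteq> 0" "\<And>i x. i < Suc m \<Longrightarrow> x \<in> B \<Longrightarrow> g i x = F i x"
    proof (rule zero_free_extension_Suc[OF Suc.prems(1) Bcl zB, of F])
      show "continuous_on B (F i)" if "i < Suc m" for i
        using F(1)[OF that] Bcl(2) by (rule continuous_on_subset)
      show "\<exists>i<Suc m. F i x \<noteq> 0" if "x \<in> B" for x
        using that Fnz by (auto simp: B_def)
    qed blast
    have KV: "closed (K - V)"
      using V clK by (metis closedin_closed_trans closedin_def double_diff openin_imp_subset order_refl topspace_euclidean_subtopology Diff_subset)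
    have Keq: "closure V \<union> (K - V) = K"
      using fr(2)[OF V] closure_subset[of V] by blast
    show "\<exists>g. (\<forall>i<Suc m. continuous_on K (g i)) \<and> (\<forall>x\<in>K. \<exists>i<Suc m. g i x \<noteq> 0) \<and>
           (\<forall>i<Suc m. \<forall>x\<in>A. g i x = f i x)"
    proof (intro exI[of _ "\<lambda>i x. if x \<in> closure V then F i x else g i x"] conjI allI impI ballI)
      fix i assume i: "i < Suc m"
      have "continuous_on (closure V \<union> (K - V)) (\<lambda>x. if x \<in> closure V then F i x else g i x)"
        using F(1)[OF i] g(1)[OF i] g(3)[OF i] fr(2)[OF V] KV
        by (intro continuous_on_If) (auto simp: B_def intro: continuous_on_subset)
      then show "continuous_on K (\<lambda>x. if x \<in> closure V then F i x else g i x)"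
        by (simp add: Keq)
    next
      fix x assume "x \<in> K"
      then show "\<exists>i<Suc m. (if x \<in> closure V then F i x else g i x) \<noteq> 0"
        using Fnz g(2) by (cases "x \<in> closure V") auto
    next
      fix i x assume "i < Suc m" "x \<in> A"
      moreover then have "x \<in> closure V"
        using D(3) closure_subset by (auto simp: V_def)
      ultimately show "(if x \<in> closure V then F i x else g i x) = f i x"
        using F(2) by simp
    qed
  qed
qed

text \<open>The coordinates of \<open>x - a\<close> have no common zero on the sphere. Extended over
  the ball without common zero and rescaled to length \<open>r\<close>, they would retract the ball
  onto its boundary.\<close>

theorem cball_not_dimension_le:
  fixes a :: "'a::euclidean_space"
  assumes "0 < r"
  shows "\<not> top_of_set (cball a r) dim_le int DIM('a) - 1"
proof
  assume "top_of_set (cball a r) dim_le int DIM('a) - 1"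
  then have z: "zero_free_extension DIM('a) (cball a r)"
    by (intro compact_dimension_le_zero_free_extension) auto
  obtain b where b: "bij_betw b {..<DIM('a)} (Basis :: 'a set)"
    using bij_betw_from_nat_into_finite[of "Basis :: 'a set", OF finite_Basis] by blast
  obtain g where g: "\<And>i. i < DIM('a) \<Longrightarrow> continuous_on (cball a r) (g i)"
    "\<And>x. x \<in> cball a r \<Longrightarrow> \<exists>i<DIM('a). g i x \<noteq> 0"
    "\<And>i x. i < DIM('a) \<Longrightarrow> x \<in> sphere a r \<Longrightarrow> g i x = (x - a) \<bullet> b i"
  proof (rule zero_free_extensionE[OF z, of "sphere a r" "\<lambda>i x. (x - a) \<bullet> b i"])
    show "\<exists>i<DIM('a). (x - a) \<bullet> b i \<noteq> 0" if "x \<in> sphere a r" for x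
    proof (rule ccontr)
      assume *: "\<not> ?thesis"
      have "(x - a) \<bullet> c = 0" if "c \<in> Basis" for c
        using * b that by (metis bij_betw_imp_surj_on imageE lessThan_iff)
      then have "x - a = 0"
        using euclidean_all_zero_iff by blast
      then show False
        using that assms by simp
    qed
  qed (auto intro!: continuous_intros)
  define G where "G x = (\<Sum>i<DIM('a). g i x *\<^sub>R b i)" for x
  have Gb: "G x \<bullet> b i = g i x" if "i < DIM('a)" for x i
  proof -
    have "b j \<bullet> b i = (if j = i then 1 else 0)" if "j < DIM('a)" for j
      using b \<open>i < DIM('a)\<close> that
      by (metis (no_types, lifting) bij_betw_def inj_on_eq_iff inner_Basis image_eqI lessThan_iff)
    then show ?thesis
      using that by (simp add: G_def inner_sum_left if_distrib[of "\<lambda>t. _ * t"] cong: if_cong)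
  qed
  have Gnz: "G x \<noteq> 0" if "x \<in> cball a r" for x
    using g(2)[OF that] Gb[of _ x] by (metis inner_zero_left)
  have Gid: "G x = x - a" if "x \<in> sphere a r" for x
  proof (rule euclidean_eqI)
    fix c :: 'a assume "c \<in> Basis"
    then obtain i where "i < DIM('a)" "c = b i"
      using b by (metis bij_betw_imp_surj_on imageE lessThan_iff)
    then show "G x \<bullet> c = (x - a) \<bullet> c"
      using Gb g(3) that by simp
  qed
  have cG: "continuous_on (cball a r) G"
    unfolding G_def using g(1) by (auto intro!: continuous_intros)
  have "retraction (cball a r) (sphere a r) (\<lambda>x. a + (r / norm (G x)) *\<^sub>R G x)"
    unfolding retraction_def
  proof (intro conjI ballI)
    show "continuous_on (cball a r) (\<lambda>x. a + (r / norm (G x)) *\<^sub>R G x)"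
      using cG Gnz by (auto intro!: continuous_intros)
    show "(\<lambda>x. a + (r / norm (G x)) *\<^sub>R G x) \<in> cball a r \<rightarrow> sphere a r"
      using Gnz assms by (auto simp: dist_norm)
    show "a + (r / norm (G x)) *\<^sub>R G x = x" if "x \<in> sphere a r" for x
      using Gid[OF that] that assms by (auto simp: dist_norm norm_minus_commute)
  qed auto
  then have "frontier (cball a r) retract_of cball a r"
    by (auto simp: retract_of_def)
  then show False
    using no_retraction_cball assms by blast
qed

section \<open>Face lattices\<close>

text \<open>So a face is determined by the indices of the points in it, whence the map
  \<open>\<phi>\<close> of the next lemma is injective.\<close>

lemma face_of_eq_convex_hull_vertices:
  fixes v :: "'k::finite \<Rightarrow> 'a::euclidean_space"
  assumes "G face_of convex hull (range v)"
  shows "G = convex hull (v ` {k. v k \<in> G})"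
proof -
  obtain S where S: "S \<subseteq> range v" "G = convex hull S"
    using face_of_convex_hull_subset[OF _ assms] finite_imp_compact[of "range v"] by auto
  have "S \<subseteq> v ` {k. v k \<in> G}"
    using S hull_subset[of S convex] by auto
  then have "G \<subseteq> convex hull (v ` {k. v k \<in> G})"
    using S(2) by (simp add: hull_mono)
  moreover have "convex hull (v ` {k. v k \<in> G}) \<subseteq> G"
    using face_of_imp_convex[OF assms] by (intro hull_minimal) auto
  ultimately show ?thesis
    by blast
qed

text \<open>The polytope is known both as a hull of points and as a solution set of affine
  inequalities, with incidence table \<open>F\<close>. Its faces are the sets \<open>X J\<close> on
  which chosen functionals vanish; passing to the indices of the points in a face turns them into
  the intersections of sets \<open>F i\<close>.\<close>

lemma lattice_isomorphic_face_lattice: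
  fixes v :: "'k::finite \<Rightarrow> 'a::euclidean_space" and h :: "'i::finite \<Rightarrow> 'a \<Rightarrow> real"
  assumes aff: "\<And>i x y u. h i ((1 - u) *\<^sub>R x + u *\<^sub>R y) = (1 - u) * h i x + u * h i y"
    and nonneg: "\<And>i k. 0 \<le> h i (v k)" and zero: "\<And>i k. h i (v k) = 0 \<longleftrightarrow> k \<in> F i"
    and hull: "\<And>z. (\<And>i. 0 \<le> h i z) \<Longrightarrow> z \<in> convex hull (range v)"
    and F: "\<Inter>(range F) = {}"
  shows "lattice_isomorphic (face_lattice (convex hull (range v))) {\<Inter>\<F> | \<F>. \<F> \<subseteq> range F}"
proof -
  define P where "P = convex hull (range v)"
  define X where "X J = {z \<in> P. \<forall>i\<in>J. h i z = 0}" for J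
  define \<phi> where "\<phi> G = {k. v k \<in> G}" for G
  have vP: "v k \<in> P" for k
    unfolding P_def by (simp add: hull_inc)
  have convP: "convex P"
    by (simp add: P_def)
  have hP: "0 \<le> h i z" if "z \<in> P" for i z
  proof -
    have "convex {z. 0 \<le> h i z}"
      by (simp add: convex_alt aff)
    then have "P \<subseteq> {z. 0 \<le> h i z}"
      unfolding P_def by (rule hull_minimal[rotated]) (auto simp: nonneg)
    then show ?thesis
      using that by auto
  qed
  have X_face: "X J face_of P" for J
    unfolding face_of_def
  proof (intro conjI ballI impI)
    show "X J \<subseteq> P"
      by (auto simp: X_def)
    show "convex (X J)"
      using convP by (auto simp: X_def aff convex_alt)
    fix a b x assume *: "a \<in> P" "b \<in> P" "x \<in> X J" "x \<in> open_segment a b"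
    then obtain u where u: "0 < u" "u < 1" "x = (1 - u) *\<^sub>R a + u *\<^sub>R b"
      by (auto simp: in_segment)
    have "h i a = 0 \<and> h i b = 0" if "i \<in> J" for i
    proof -
      have "(1 - u) * h i a + u * h i b = 0"
        using * that u(3) by (auto simp: X_def aff)
      moreover have "0 \<le> (1 - u) * h i a" "0 \<le> u * h i b"
        using hP * u by auto
      ultimately have "(1 - u) * h i a = 0" "u * h i b = 0"
        by linarith+
      then show ?thesis
        using u by auto
    qed
    then show "a \<in> X J" "b \<in> X J"
      using * by (auto simp: X_def)
  qed
  have \<phi>X: "\<phi> (X J) = \<Inter>(F ` J)" for J
    using vP zero by (auto simp: \<phi>_def X_def)
  have repr: "G = convex hull (v ` \<phi> G)" if "G face_of P" for G
    using face_of_eq_convex_hull_vertices[of G v] that by (simp add: P_def \<phi>_def)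
  \<comment> \<open>No \<open>v k\<close> is a zero of all functionals, which exhibits the empty
    face as some \<open>X J\<close>.\<close>
  have "X UNIV = {}"
    using repr[OF X_face, of UNIV] F by (simp add: \<phi>X)
  have face_X: "\<exists>J. G = X J" if G: "G face_of P" for G
  proof (cases "G = {}")
    case True
    then show ?thesis
      using \<open>X UNIV = {}\<close> by blast
  next
    case False
    define J where "J = {i. \<forall>z\<in>G. h i z = 0}"
    have GP: "G \<subseteq> P"
      using G face_of_imp_subset by blast
    have convG: "convex G"
      using G face_of_imp_convex by blast
    \<comment> \<open>Averaging points of \<open>G\<close> yields one at which every functional
      outside \<open>J\<close> is positive, a substitute for a relative interior point.\<close>
    have "\<exists>g\<in>G. \<forall>i\<in>S. 0 < h i g" if "finite S" "S \<inter> J = {}" for S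
      using that
    proof (induction S)
      case empty
      then show ?case
        using False by auto
    next
      case (insert i S)
      then obtain g where g: "g \<in> G" "\<forall>i\<in>S. 0 < h i g"
        by auto
      obtain z where z: "z \<in> G" "h i z \<noteq> 0"
        using insert.prems by (auto simp: J_def)
      define w where "w = (1 - 1/2) *\<^sub>R g + (1/2::real) *\<^sub>R z"
      have hw: "h j w = h j g / 2 + h j z / 2" for j
        unfolding w_def by (subst aff) simp
      have nn: "0 \<le> h j g" "0 \<le> h j z" for j
        using g(1) z(1) GP hP by auto
      have "w \<in> G"
        unfolding w_def using convG g(1) z(1) by (intro convexD_alt) auto
      moreover have "0 < h j w" if "j \<in> insert i S" for j
        using that z(2) g(2) nn[of j] by (cases "j = i") (auto simp: hw intro: add_nonneg_pos add_pos_nonneg)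
      ultimately show ?case
        by blast
    qed
    from this[of "- J"] obtain g where g: "g \<in> G" "\<And>i. i \<notin> J \<Longrightarrow> 0 < h i g"
      by auto
    have "z \<in> G" if z: "z \<in> X J" for z
    proof (cases "z = g")
      case True
      then show ?thesis
        using g(1) by simp
    next
      case zg: False
      have zP: "z \<in> P"
        using z by (auto simp: X_def)
      \<comment> \<open>\<open>e\<close> says how far the segment from \<open>z\<close> to
        \<open>g\<close> can be prolonged beyond \<open>g\<close> inside \<open>P\<close>; the
        endpoint is \<open>w\<close>. The inserted 1 makes the minimum one over a nonempty set, and
        \<open>1 + h i z\<close> avoids a zero denominator. As \<open>g\<close> is interior to the
        segment from \<open>z\<close> to \<open>w\<close>, the face \<open>G\<close> contains
        \<open>z\<close>.\<close>
      define e where "e = Min (insert 1 ((\<lambda>i. h i g / (1 + h i z)) ` (- J)))"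
      have e0: "0 < e"
        unfolding e_def using g(2) hP[OF zP] by (subst Min_gr_iff) (auto intro!: divide_pos_pos add_pos_nonneg)
      have e: "e \<le> h i g / (1 + h i z)" if "i \<notin> J" for i
        unfolding e_def using that by (intro Min_le) auto
      define w where "w = (1 - (- e)) *\<^sub>R g + (- e) *\<^sub>R z"
      have "0 \<le> h i w" for i
      proof (cases "i \<in> J")
        case True
        then have "h i g = 0" "h i z = 0"
          using g(1) z by (auto simp: J_def X_def)
        then show ?thesis
          unfolding w_def by (subst aff) simp
      next
        case False
        have "e * (1 + h i z) \<le> h i g"
          using e[OF False] hP[OF zP, of i] by (simp add: pos_le_divide_eq)
        moreover have "0 \<le> e * h i g"
          using e0 g(2)[OF False] by simp
        ultimately show ?thesis
          unfolding w_def using e0 by (subst aff) (simp add: algebra_simps)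
      qed
      then have wP: "w \<in> P"
        unfolding P_def by (rule hull)
      have gw: "g = (1 - 1 / (1 + e)) *\<^sub>R z + (1 / (1 + e)) *\<^sub>R w"
      proof -
        have "(1 + e) *\<^sub>R g = e *\<^sub>R z + w"
          by (simp add: w_def)
        then have "g = (1 / (1 + e)) *\<^sub>R (e *\<^sub>R z + w)"
          using e0 by (metis (no_types) add_pos_pos divide_inverse_commute inverse_eq_divide less_irrefl mult.right_neutral scaleR_one scaleR_scaleR right_inverse mult.commute zero_less_one)
        moreover have "1 - 1 / (1 + e) = (1 / (1 + e)) * e"
          using e0 by (simp add: field_simps)
        ultimately show ?thesis
          by (simp add: scaleR_add_right)
      qed
      have "z \<noteq> w"
      proof
        assume "z = w"
        then have "g = z"
          using gw by (metis scaleR_collapse)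
        then show False
          using zg by simp
      qed
      then have "g \<in> open_segment z w"
        unfolding in_segment using gw e0 by (intro conjI exI[of _ "1 / (1 + e)"]) auto
      then show ?thesis
        using G g(1) zP wP by (auto simp: face_of_def)
    qed
    moreover have "G \<subseteq> X J"
      using GP by (auto simp: X_def J_def)
    ultimately show ?thesis
      by blast
  qed
  have "bij_betw \<phi> {G. G face_of P} {\<Inter>\<F> | \<F>. \<F> \<subseteq> range F}"
    unfolding bij_betw_def
  proof
    show "inj_on \<phi> {G. G face_of P}"
      by (rule inj_onI) (metis mem_Collect_eq repr)
    have 1: "\<phi> G \<in> {\<Inter>\<F> | \<F>. \<F> \<subseteq> range F}" if "G face_of P" for G
      using face_X[OF that] \<phi>X by blast
    have 2: "\<Inter>\<F> \<in> \<phi> ` {G. G face_of P}" if FF: "\<F> \<subseteq> range F" for \<F>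
    proof -
      obtain J where "\<F> = F ` J"
        using FF by (auto simp: subset_image_iff)
      then have "\<Inter>\<F> = \<phi> (X J)"
        by (simp add: \<phi>X)
      then show ?thesis
        using X_face by blast
    qed
    show "\<phi> ` {G. G face_of P} = {\<Inter>\<F> | \<F>. \<F> \<subseteq> range F}"
    proof
      show "\<phi> ` {G. G face_of P} \<subseteq> {\<Inter>\<F> | \<F>. \<F> \<subseteq> range F}"
        using 1 by (intro image_subsetI) simp
      show "{\<Inter>\<F> | \<F>. \<F> \<subseteq> range F} \<subseteq> \<phi> ` {G. G face_of P}"
        using 2 by (intro subsetI) auto
    qed
  qed
  moreover have "G \<subseteq> G' \<longleftrightarrow> \<phi> G \<subseteq> \<phi> G'" if "G face_of P" "G' face_of P" for G G'
  proof
    show "\<phi> G \<subseteq> \<phi> G'" if "G \<subseteq> G'"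
      using that by (auto simp: \<phi>_def)
    show "G \<subseteq> G'" if "\<phi> G \<subseteq> \<phi> G'"
      using repr[OF \<open>G face_of P\<close>] repr[OF \<open>G' face_of P\<close>] that by (metis hull_mono image_mono)
  qed
  ultimately show ?thesis
    unfolding lattice_isomorphic_def face_lattice_def P_def by blast
qed

text \<open>Each atom of the lattice comes from an extreme point of the hull, and extreme points are
  among the \<open>x j\<close>. With as many atoms as points, counting leaves no repeated and no
  non-extreme point.\<close>

lemma lattice_isomorphic_points_extreme:
  fixes x :: "'n::finite \<Rightarrow> 'a::euclidean_space" and \<L> :: "'k::finite set set"
  assumes iso: "lattice_isomorphic (face_lattice (convex hull (range x))) \<L>"
    and \<L>: "{} \<in> \<L>" "\<And>k. {k} \<in> \<L>" and card: "CARD('k) = CARD('n)"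
  shows "inj x" and "x j extreme_point_of convex hull (range x)"
proof -
  define P where "P = convex hull (range x)"
  obtain \<phi> where \<phi>: "bij_betw \<phi> {G. G face_of P} \<L>"
    "\<And>G H. G face_of P \<Longrightarrow> H face_of P \<Longrightarrow> G \<subseteq> H \<longleftrightarrow> \<phi> G \<subseteq> \<phi> H"
    using iso by (auto simp: lattice_isomorphic_def face_lattice_def P_def)
  have "\<phi> {} = {}"
  proof -
    obtain G where "G face_of P" "\<phi> G = {}"
      using \<phi>(1) \<L>(1) by (auto simp: bij_betw_def)
    then show ?thesis
      using \<phi>(2)[of "{}" G] by auto
  qed
  have "\<exists>e. e extreme_point_of P \<and> \<phi> {e} = {k}" for k
  proof -
    obtain G where G: "G face_of P" "\<phi> G = {k}"
      using \<phi>(1) \<L>(2)[of k] by (auto simp: bij_betw_def)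
    then have "G \<noteq> {}"
      using \<open>\<phi> {} = {}\<close> by auto
    moreover have "compact G" "convex G"
      using G(1) face_of_imp_compact[of P G] face_of_imp_convex[of G P]
      by (auto simp: P_def finite_imp_compact compact_convex_hull)
    ultimately obtain e where "e extreme_point_of G"
      using extreme_point_exists_convex by blast
    then have e: "e extreme_point_of P" "{e} \<subseteq> G"
      using G(1) by (auto simp: extreme_point_of_face)
    then have fe: "{e} face_of P"
      by (simp add: face_of_singleton)
    have "\<phi> {e} \<subseteq> {k}"
      using \<phi>(2)[OF fe G(1)] e(2) G(2) by simp
    moreover have "\<phi> {e} \<noteq> {}"
      using \<phi>(2)[OF fe empty_face_of] \<open>\<phi> {} = {}\<close> by auto
    ultimately show ?thesis
      using e(1) by blast
  qed
  then obtain e where e: "\<And>k. e k extreme_point_of P" "\<And>k. \<phi> {e k} = {k}"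
    by metis
  have "inj e"
    by (metis e(2) injI singleton_inject)
  have sub: "range e \<subseteq> range x"
    using e(1) by (auto simp: P_def dest!: extreme_point_of_convex_hull)
  have "card (range e) = CARD('n)"
    using \<open>inj e\<close> card by (simp add: card_image)
  then have eq: "range e = range x"
    using sub by (metis card_image_le card_seteq finite finite_imageI)
  then show "inj x"
    using \<open>card (range e) = CARD('n)\<close> by (intro eq_card_imp_inj_on) auto
  have "x j \<in> range e"
    using eq by auto
  then show "x j extreme_point_of convex hull (range x)"
    using e(1) by (auto simp: P_def)
qed

text \<open>A proper face has smaller affine dimension, so each strict step of the chain costs one
  dimension, starting from at least \<open>-1\<close>.\<close>

lemma lattice_isomorphic_chain_aff_dim:
  fixes P :: "'a::euclidean_space set"
  assumes iso: "lattice_isomorphic (face_lattice P) \<L>" and P: "convex P"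
    and A: "\<And>i. i \<le> m \<Longrightarrow> A i \<in> \<L>" "\<And>i. i < m \<Longrightarrow> A i \<subset> A (Suc i)"
  shows "int m - 1 \<le> aff_dim P"
proof -
  obtain \<phi> where \<phi>: "bij_betw \<phi> {G. G face_of P} \<L>"
    "\<And>G H. G face_of P \<Longrightarrow> H face_of P \<Longrightarrow> G \<subseteq> H \<longleftrightarrow> \<phi> G \<subseteq> \<phi> H"
    using iso by (auto simp: lattice_isomorphic_def face_lattice_def)
  have "\<forall>i. \<exists>G. i \<le> m \<longrightarrow> G face_of P \<and> \<phi> G = A i"
    using \<phi>(1) A(1) by (force simp: bij_betw_def)
  then obtain G where G: "\<And>i. i \<le> m \<Longrightarrow> G i face_of P \<and> \<phi> (G i) = A i"
    by metis
  have "int i - 1 \<le> aff_dim (G i)" if "i \<le> m" for i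
    using that
  proof (induction i)
    case 0
    then show ?case
      using aff_dim_geq by simp
  next
    case (Suc i)
    then have "G i \<subset> G (Suc i)"
      using \<phi>(2) G[of i] G[of "Suc i"] A(2)[of i] by (metis Suc_leD Suc_le_lessD psubset_eq subset_antisym)
    then have "G i face_of G (Suc i)" "G i \<noteq> G (Suc i)"
      using G[of i] G[of "Suc i"] Suc.prems face_of_imp_subset[of "G (Suc i)" P]
        face_of_subset[of "G i" P "G (Suc i)"] by auto
    then have "aff_dim (G i) < aff_dim (G (Suc i))"
      using G[of "Suc i"] Suc.prems face_of_aff_dim_lt face_of_imp_convex by blast
    then show ?case
      using Suc by simp
  qed
  then have "int m - 1 \<le> aff_dim (G m)"
    by simp
  also have "\<dots> \<le> aff_dim P"
    using G[of m] by (simp add: aff_dim_subset face_of_imp_subset)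
  finally show ?thesis .
qed

section \<open>Vertices and a flag of the combinatorial type\<close>

instance E33_vertex :: finite
proof
  have "(UNIV :: E33_vertex set) = (\<lambda>(i, j). V i j) ` UNIV \<union> range V1 \<union> range V2"
  proof -
    have "x \<in> (\<lambda>(i, j). V i j) ` UNIV \<union> range V1 \<union> range V2" for x
      by (cases x) auto
    then show ?thesis
      by auto
  qed
  then show "finite (UNIV :: E33_vertex set)"
    by (metis finite finite_UnI finite_imageI)
qed

lemma card_E33_vertex: "CARD(E33_vertex) = 15"
proof -
  have eq: "(UNIV :: E33_vertex set) = (\<lambda>(i, j). V i j) ` UNIV \<union> (range V1 \<union> range V2)"
  proof -
    have "x \<in> (\<lambda>(i, j). V i j) ` UNIV \<union> (range V1 \<union> range V2)" for x
      by (cases x) auto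
    then show ?thesis
      by auto
  qed
  have "card (range V1 \<union> range V2) = 6"
    by (subst card_Un_disjoint) (auto simp: card_image inj_on_def)
  moreover have "card ((\<lambda>(i, j). V i j) ` UNIV) = 9"
    by (subst card_image) (auto simp: inj_on_def)
  ultimately show ?thesis
    unfolding eq by (subst card_Un_disjoint) auto
qed

lemma E33_face_latticeI: "\<F> \<subseteq> E33_facets \<Longrightarrow> \<Inter>\<F> = S \<Longrightarrow> S \<in> E33_face_lattice"
  by (auto simp: E33_face_lattice_def)

lemma E33_octahedron: "{V i j, V (i + 1) j, V i (j + 1), V (i + 1) (j + 1), V1 i, V2 j} \<in> E33_facets"
  and E33_bipyramid1: "{V i 0, V i 1, V i 2, V1 (i - 1), V1 i} \<in> E33_facets"
  and E33_bipyramid2: "{V 0 j, V 1 j, V 2 j, V2 (j - 1), V2 j} \<in> E33_facets"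
  unfolding E33_facets_def by blast+

lemma three_eq_0: "(3::3) = 0" and minus_one_eq_2: "(-1::3) = 2"
  by simp_all

lemma exhaust_mod_3: "(i::3) = 0 \<or> i = 1 \<or> i = 2"
  using exhaust_3[of i] by auto

text \<open>\<open>V i j\<close> is where the two bipyramids through it meet, one of either kind;
  \<open>V1 i\<close> and \<open>V2 i\<close> are where the bipyramids \<open>i\<close> and
  \<open>i + 1\<close> of one kind meet.\<close>

lemma singleton_in_E33_face_lattice: "{k} \<in> E33_face_lattice"
proof (cases k)
  case (V i j)
  show ?thesis
    by (rule E33_face_latticeI[of "{{V i 0, V i 1, V i 2, V1 (i - 1), V1 i}, {V 0 j, V 1 j, V 2 j, V2 (j - 1), V2 j}}"])
     (use E33_bipyramid1[of i] E33_bipyramid2[of j] exhaust_mod_3[of i] exhaust_mod_3[of j] in \<open>auto simp: V\<close>)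
next
  case (V1 i)
  show ?thesis
    by (rule E33_face_latticeI[of "{{V i 0, V i 1, V i 2, V1 (i - 1), V1 i}, {V (i+1) 0, V (i+1) 1, V (i+1) 2, V1 (i+1 - 1), V1 (i+1)}}"])
     (use E33_bipyramid1[of i] E33_bipyramid1[of "i+1"] exhaust_mod_3[of i] in \<open>auto simp: V1\<close>)
next
  case (V2 i)
  show ?thesis
    by (rule E33_face_latticeI[of "{{V 0 i, V 1 i, V 2 i, V2 (i - 1), V2 i}, {V 0 (i+1), V 1 (i+1), V 2 (i+1), V2 (i+1 - 1), V2 (i+1)}}"])
     (use E33_bipyramid2[of i] E33_bipyramid2[of "i+1"] exhaust_mod_3[of i] in \<open>auto simp: V2\<close>)
qed

lemma empty_in_E33_face_lattice: "{} \<in> E33_face_lattice"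
proof -
  obtain \<F> \<G> where "\<F> \<subseteq> E33_facets" "\<Inter>\<F> = {V1 0}" "\<G> \<subseteq> E33_facets" "\<Inter>\<G> = {V2 0}"
    using singleton_in_E33_face_lattice[of "V1 0"] singleton_in_E33_face_lattice[of "V2 0"]
    by (auto simp: E33_face_lattice_def)
  then show ?thesis
    by (intro E33_face_latticeI[of "\<F> \<union> \<G>"]) (auto simp: Inter_Un_distrib)
qed

text \<open>The flag of empty face, vertex, edge, triangle, octahedron and whole polytope has five
  strict steps. Hence realisations in \<open>real ^ 4\<close> are full-dimensional, which makes
  limits of projective maps invertible later on.\<close>

lemma E33_aff_dim:
  fixes P :: "'a::euclidean_space set"
  assumes iso: "lattice_isomorphic (face_lattice P) E33_face_lattice" and P: "convex P"
  shows "4 \<le> aff_dim P"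
proof -
  let ?A = "[{}, {V 0 0}, {V 0 0, V1 0}, {V 0 0, V 0 1, V1 0},
    {V 0 0, V 1 0, V 0 1, V 1 1, V1 0, V2 0}, UNIV]"
  have O: "{V 0 0, V 1 0, V 0 1, V 1 1, V1 0, V2 0} \<in> E33_facets"
    and O': "{V 0 2, V 1 2, V 0 0, V 1 0, V1 0, V2 2} \<in> E33_facets"
    and B: "{V 0 0, V 0 1, V 0 2, V1 2, V1 0} \<in> E33_facets"
    using E33_octahedron[of 0 0] E33_octahedron[of 0 2] E33_bipyramid1[of 0] by (simp_all add: three_eq_0 minus_one_eq_2)
  have "set ?A \<subseteq> E33_face_lattice"
  proof -
    have "{V 0 0, V1 0} \<in> E33_face_lattice"
      by (rule E33_face_latticeI[of "{{V 0 0, V 1 0, V 0 1, V 1 1, V1 0, V2 0},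
        {V 0 2, V 1 2, V 0 0, V 1 0, V1 0, V2 2}, {V 0 0, V 0 1, V 0 2, V1 2, V1 0}}"])
        (use O O' B in auto)
    moreover have "{V 0 0, V 0 1, V1 0} \<in> E33_face_lattice"
      by (rule E33_face_latticeI[of "{{V 0 0, V 1 0, V 0 1, V 1 1, V1 0, V2 0},
        {V 0 0, V 0 1, V 0 2, V1 2, V1 0}}"])
        (use O B in auto)
    moreover have "{V 0 0, V 1 0, V 0 1, V 1 1, V1 0, V2 0} \<in> E33_face_lattice"
      by (rule E33_face_latticeI[of "{{V 0 0, V 1 0, V 0 1, V 1 1, V1 0, V2 0}}"]) (use O in auto)
    moreover have "UNIV \<in> E33_face_lattice"
      by (rule E33_face_latticeI[of "{}"]) auto
    ultimately show ?thesis
      using empty_in_E33_face_lattice singleton_in_E33_face_lattice by simp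
  qed
  then have mem: "?A ! i \<in> E33_face_lattice" if "i \<le> 5" for i
  proof -
    have "?A ! i \<in> set ?A"
      using that by (intro nth_mem) simp
    then show ?thesis
      using \<open>set ?A \<subseteq> E33_face_lattice\<close> by blast
  qed
  have less: "?A ! i \<subset> ?A ! Suc i" if "i < 5" for i
  proof -
    have "V2 1 \<notin> {V 0 0, V 1 0, V 0 1, V 1 1, V1 0, V2 0}"
      by simp
    then have 4: "{V 0 0, V 1 0, V 0 1, V 1 1, V1 0, V2 0} \<subset> (UNIV :: E33_vertex set)"
      by blast
    have psubI: "S \<subset> T" if "x \<in> T" "x \<notin> S" "S \<subseteq> T" for x and S T :: "E33_vertex set"
      using that by blast
    have 3: "{V 0 0, V 0 1, V1 0} \<subset> {V 0 0, V 1 0, V 0 1, V 1 1, V1 0, V2 0}"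
      by (rule psubI[of "V2 0"]) simp_all
    have 2: "{V 0 0, V1 0} \<subset> {V 0 0, V 0 1, V1 0}"
      by (rule psubI[of "V 0 1"]) simp_all
    have 1: "{V 0 0} \<subset> {V 0 0, V1 0}"
      by (rule psubI[of "V1 0"]) simp_all
    have 0: "{} \<subset> {V 0 0}"
      by (rule psubI[of "V 0 0"]) simp_all
    have "i = 0 \<or> i = 1 \<or> i = 2 \<or> i = 3 \<or> i = 4"
      using that by linarith
    then show ?thesis
      by (elim disjE) (insert 0 1 2 3 4, simp_all only: nth_Cons_0 nth_Cons_Suc eval_nat_numeral BitM.simps One_nat_def)
  qed
  have "int 5 - 1 \<le> aff_dim P"
    by (rule lattice_isomorphic_chain_aff_dim[OF iso P, where A = "\<lambda>i. ?A ! i"]) (fact mem, fact less)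
  then show ?thesis
    by simp
qed

section \<open>Configurations over a product of triangles\<close>

lemma sum_mod_3: "sum f (UNIV :: 3 set) = f 0 + f 1 + f (2::3)"
  by (simp add: sum_3 three_eq_0 ac_simps)

text \<open>Barycentric coordinates of the first two entries in the standard triangle, with index 0
  for the vertex at the origin. \<open>mu\<close> treats the last two entries likewise, and
  \<open>pt\<close> recovers the point from both.\<close>

definition lam :: "3 \<Rightarrow> real ^ 4 \<Rightarrow> real" where
  "lam k z = (if k = 1 then z $ 1 else if k = 2 then z $ 2 else 1 - z $ 1 - z $ 2)"

definition mu :: "3 \<Rightarrow> real ^ 4 \<Rightarrow> real" where
  "mu k z = (if k = 1 then z $ 3 else if k = 2 then z $ 4 else 1 - z $ 3 - z $ 4)"

definition pt :: "(3 \<Rightarrow> real) \<Rightarrow> (3 \<Rightarrow> real) \<Rightarrow> real ^ 4" where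
  "pt a b = (\<chi> i. if i = 1 then a 1 else if i = 2 then a 2 else if i = 3 then b 1 else b 2)"

definition unit_coords :: "3 \<Rightarrow> 3 \<Rightarrow> real" where
  "unit_coords i k = of_bool (k = i)"

lemma lam_pt: "sum a UNIV = 1 \<Longrightarrow> lam k (pt a b) = a k"
  and mu_pt: "sum b UNIV = 1 \<Longrightarrow> mu k (pt a b) = b k"
  using exhaust_mod_3[of k] by (auto simp: lam_def mu_def pt_def sum_mod_3)

lemma pt_lam_mu: "pt (\<lambda>k. lam k z) (\<lambda>k. mu k z) = z"
  by (simp add: pt_def lam_def mu_def vec_eq_iff forall_4)

lemma sum_lam: "(\<Sum>k\<in>UNIV. lam k z) = 1" and sum_mu: "(\<Sum>k\<in>UNIV. mu k z) = 1"
  by (simp_all add: sum_mod_3 lam_def mu_def)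

lemma sum_unit_coords: "sum (unit_coords i) UNIV = 1"
  by (simp add: unit_coords_def)

lemma lam_affine: "lam k ((1 - u) *\<^sub>R x + u *\<^sub>R y) = (1 - u) * lam k x + u * lam k y"
  and mu_affine: "mu k ((1 - u) *\<^sub>R x + u *\<^sub>R y) = (1 - u) * mu k x + u * mu k y"
  by (auto simp: lam_def mu_def algebra_simps)

lemma eq_if_lam_mu_eq: "(\<And>k. lam k y = lam k z) \<Longrightarrow> (\<And>k. mu k y = mu k z) \<Longrightarrow> y = z"
  by (metis pt_lam_mu ext)

text \<open>Each factor is the combination of its triangle vertices with the barycentric weights,
  and the weights of either factor sum to 1. Signs are arbitrary here.\<close>

lemma product_combination:
  "z = (\<Sum>(k, l)\<in>UNIV. (lam k z * mu l z) *\<^sub>R pt (unit_coords k) (unit_coords l))"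
proof -
  have s: "lam 0 z = 1 - lam 1 z - lam 2 z" "mu 0 z = 1 - mu 1 z - mu 2 z"
    by (simp_all add: lam_def mu_def)
  have "(\<Sum>(k, l)\<in>UNIV. (lam k z * mu l z) *\<^sub>R pt (unit_coords k) (unit_coords l))
      = pt (\<lambda>k. lam k z) (\<lambda>k. mu k z)"
    unfolding UNIV_Times_UNIV[symmetric] sum.cartesian_product[symmetric]
    by (simp add: sum_mod_3 vec_eq_iff forall_4 pt_def unit_coords_def s algebra_simps)
  then show ?thesis
    by (simp add: pt_lam_mu)
qed

text \<open>Asking only for the products of nonzero weight covers the faces of the product of
  triangles as well; the limit argument applies this to a face that misses a given vertex.\<close>

lemma in_convex_hull_products:
  assumes "\<And>k. 0 \<le> lam k z" "\<And>k. 0 \<le> mu k z" "convex H"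
    and "\<And>k l. lam k z \<noteq> 0 \<Longrightarrow> mu l z \<noteq> 0 \<Longrightarrow> pt (unit_coords k) (unit_coords l) \<in> H"
  shows "z \<in> H"
proof -
  define I where "I = {k. lam k z \<noteq> 0} \<times> {l. mu l z \<noteq> 0}"
  have "(\<Sum>(k, l)\<in>UNIV. lam k z * mu l z) = (\<Sum>k\<in>UNIV. lam k z) * (\<Sum>l\<in>UNIV. mu l z)"
    unfolding UNIV_Times_UNIV[symmetric] sum.cartesian_product[symmetric] sum_product ..
  moreover have "(\<Sum>(k, l)\<in>I. lam k z * mu l z) = (\<Sum>(k, l)\<in>UNIV. lam k z * mu l z)"
    by (rule sum.mono_neutral_left) (auto simp: I_def)
  ultimately have "(\<Sum>p\<in>I. lam (fst p) z * mu (snd p) z) = 1"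
    by (simp add: sum_lam sum_mu case_prod_unfold)
  then have "(\<Sum>p\<in>I. (lam (fst p) z * mu (snd p) z) *\<^sub>R pt (unit_coords (fst p)) (unit_coords (snd p))) \<in> H"
    using assms by (intro convex_sum) (auto simp: I_def)
  also have "(\<Sum>p\<in>I. (lam (fst p) z * mu (snd p) z) *\<^sub>R pt (unit_coords (fst p)) (unit_coords (snd p))) =
      (\<Sum>(k, l)\<in>UNIV. (lam k z * mu l z) *\<^sub>R pt (unit_coords k) (unit_coords l))"
    unfolding case_prod_unfold by (rule sum.mono_neutral_left) (auto simp: I_def)
  finally show ?thesis
    by (simp add: product_combination[symmetric])
qed

text \<open>Remove the share \<open>c\<close> of \<open>v\<close> from \<open>z\<close>. The
  remaining coordinates are nonnegative of sum \<open>1 - c\<close>, so \<open>c \<le> 1\<close>;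
  rescaled, they belong to a point \<open>w\<close> of the product of triangles, and
  \<open>z\<close> lies between \<open>v\<close> and \<open>w\<close>.\<close>

lemma in_convex_if_cone:
  assumes c: "0 \<le> c" and H: "convex H" "v \<in> H" "\<And>k l. pt (unit_coords k) (unit_coords l) \<in> H"
    and lam: "\<And>k. 0 \<le> lam k z - c * lam k v" and mu: "\<And>k. 0 \<le> mu k z - c * mu k v"
  shows "z \<in> H"
proof -
  have sl: "(\<Sum>k\<in>UNIV. lam k z - c * lam k v) = 1 - c"
    by (simp add: sum_subtractf sum_lam sum_distrib_left[symmetric])
  have sm: "(\<Sum>k\<in>UNIV. mu k z - c * mu k v) = 1 - c"
    by (simp add: sum_subtractf sum_mu sum_distrib_left[symmetric])
  have "c \<le> 1"
    using sum_nonneg[of UNIV "\<lambda>k. lam k z - c * lam k v"] lam sl by simp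
  show ?thesis
  proof (cases "c = 1")
    case True
    have "\<forall>k\<in>UNIV. lam k z - c * lam k v = 0"
      using sl lam True by (subst sum_nonneg_eq_0_iff[symmetric]) auto
    moreover have "\<forall>k\<in>UNIV. mu k z - c * mu k v = 0"
      using sm mu True by (subst sum_nonneg_eq_0_iff[symmetric]) auto
    ultimately have "z = v"
      using True by (intro eq_if_lam_mu_eq) auto
    then show ?thesis
      using H by simp
  next
    case False
    define b where "b = 1 / (1 - c)"
    have "0 < 1 - c"
      using False \<open>c \<le> 1\<close> by simp
    then have b: "0 < b" "(1 - c) * b = 1"
      by (simp_all add: b_def)
    define w where "w = (1 - b) *\<^sub>R v + b *\<^sub>R z"
    have bc: "1 - b = - (b * c)"
      using b(2) by (simp add: algebra_simps)
    have "lam k w = (1 - b) * lam k v + b * lam k z" "mu k w = (1 - b) * mu k v + b * mu k z" for k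
      unfolding w_def by (rule lam_affine mu_affine)+
    then have "lam k w = b * (lam k z - c * lam k v)" "mu k w = b * (mu k z - c * mu k v)" for k
      by (simp_all add: bc right_diff_distrib)
    then have "0 \<le> lam k w" "0 \<le> mu k w" for k
      using lam[of k] mu[of k] b(1) by (metis mult_nonneg_nonneg less_imp_le)+
    then have "w \<in> H"
      using H(1,3) by (rule in_convex_hull_products)
    moreover have "z = (1 - (1 - c)) *\<^sub>R v + (1 - c) *\<^sub>R w"
    proof -
      have "(1 - c) *\<^sub>R w = ((1 - c) * (1 - b)) *\<^sub>R v + ((1 - c) * b) *\<^sub>R z"
        by (simp add: w_def scaleR_add_right)
      moreover have "(1 - c) * (1 - b) = - c"
        using b(2) by (simp add: algebra_simps)
      ultimately show ?thesis
        using b(2) by simp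
    qed
    ultimately show ?thesis
      using convexD_alt[OF H(1,2), of w "1 - c"] \<open>c \<le> 1\<close> c by simp
  qed
qed

text \<open>In barycentric coordinates of a triangle, the vertex of a circumscribed triangle that
  lies beyond the edge with endpoints \<open>i\<close> and \<open>i + 1\<close>. The line through the vertex \<open>i\<close> has the equation
  \<open>\<lambda>\<^bsub>i + 1\<^esub> + t\<^sub>i \<lambda>\<^bsub>i - 1\<^esub> = 0\<close>.\<close>

definition circum :: "(3 \<Rightarrow> real) \<Rightarrow> (3 \<Rightarrow> real) \<Rightarrow> 3 \<Rightarrow> 3 \<Rightarrow> real" where
  "circum t p i k = (if k = i - 1 then - p i else if k = i + 1 then t i * p i else p i / t (i + 1))"

lemmas three_simps = three_eq_0 minus_one_eq_2

lemma eq_cyclic: "(i :: 3) = j \<or> i = j + 1 \<or> i = j - 1"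
  using exhaust_mod_3[of i] exhaust_mod_3[of j] by (auto simp: three_simps)

lemma cyclic_simps: "(i :: 3) + 1 + 1 = i - 1" "2 + i = i - 1" "i - 1 - 1 = i + 1" "i - 1 \<noteq> i + 1" "i + 1 \<noteq> i - 1"
    "i - 1 \<noteq> i" "i \<noteq> i - 1"
  using exhaust_mod_3[of i] by (auto simp: three_simps)

lemma cyclic_neq: "(k :: 3) = i \<or> k = i + 1 \<longleftrightarrow> k \<noteq> i - 1"
  using eq_cyclic[of k i] cyclic_simps[of i] by auto

lemma circum_simps:
  "circum t p i (i - 1) = - p i" "circum t p i (i + 1) = t i * p i" "circum t p i i = p i / t (i + 1)"
  by (simp_all add: circum_def cyclic_simps)

text \<open>The value \<open>p i / t (i + 1)\<close> in \<open>circum\<close> puts vertex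
  \<open>i\<close> on line \<open>i + 1\<close> as well as on line \<open>i\<close>. So line
  \<open>i\<close> meets the vertices \<open>i\<close> and \<open>i - 1\<close>, and at vertex
  \<open>i + 1\<close> both summands are positive.\<close>

lemma circum_line:
  assumes "\<And>i. 0 < t i" "\<And>i. 0 < p i"
  shows "0 \<le> circum t p k (i + 1) + t i * circum t p k (i - 1)"
    and "circum t p k (i + 1) + t i * circum t p k (i - 1) = 0 \<longleftrightarrow> k = i \<or> k = i - 1"
proof -
  consider "k = i" | "k = i - 1" | "k = i + 1"
    using eq_cyclic by blast
  then have "0 \<le> circum t p k (i + 1) + t i * circum t p k (i - 1) \<and>
    (circum t p k (i + 1) + t i * circum t p k (i - 1) = 0 \<longleftrightarrow> k = i \<or> k = i - 1)"
  proof cases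
    case 1
    then show ?thesis
      by (simp add: circum_simps)
  next
    case 2
    then show ?thesis
      using assms(1)[of i] circum_simps(1,3)[of t p "i - 1"] by (simp add: cyclic_simps)
  next
    case 3
    have "0 < p (i + 1) / t (i - 1) + t i * (t (i + 1) * p (i + 1))"
      using assms by (intro add_pos_pos divide_pos_pos mult_pos_pos) auto
    then show ?thesis
      using 3 circum_simps(2,3)[of t p "i + 1"] by (simp add: cyclic_simps)
  qed
  then show "0 \<le> circum t p k (i + 1) + t i * circum t p k (i - 1)"
    and "circum t p k (i + 1) + t i * circum t p k (i - 1) = 0 \<longleftrightarrow> k = i \<or> k = i - 1"
    by blast+
qed

lemma circum_pos:
  assumes "\<And>i. 0 < t i" "\<And>i. 0 < p i" "k \<noteq> i - 1"
  shows "0 < circum t p i k"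
  using assms by (auto simp: circum_def)

lemma sum_circum:
  assumes "p i * (t i + 1 / t (i + 1) - 1) = 1"
  shows "sum (circum t p i) UNIV = 1"
  using exhaust_mod_3[of i] assms
  by (auto simp: circum_def sum_mod_3 three_simps algebra_simps divide_inverse)

text \<open>There are 9 + 3 + 3 facets as there are vertices, so the vertex type also serves to
  index the facets: \<open>V\<close> for octahedra, \<open>V1\<close> and \<open>V2\<close> for
  bipyramids.\<close>

definition E33_facet :: "E33_vertex \<Rightarrow> E33_vertex set" where
  "E33_facet f = (case f of
     V i j \<Rightarrow> {V i j, V (i + 1) j, V i (j + 1), V (i + 1) (j + 1), V1 i, V2 j}
   | V1 i \<Rightarrow> {V i 0, V i 1, V i 2, V1 (i - 1), V1 i}
   | V2 j \<Rightarrow> {V 0 j, V 1 j, V 2 j, V2 (j - 1), V2 j})"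

lemma range_E33_facet: "range E33_facet = E33_facets"
proof
  show "range E33_facet \<subseteq> E33_facets"
  proof
    fix S assume "S \<in> range E33_facet"
    then obtain f where "S = E33_facet f"
      by blast
    then show "S \<in> E33_facets"
      by (cases f) (auto simp: E33_facet_def E33_facets_def)
  qed
  have "E33_facet (V i j) \<in> range E33_facet" "E33_facet (V1 i) \<in> range E33_facet"
      "E33_facet (V2 j) \<in> range E33_facet" for i j
    by blast+
  then show "E33_facets \<subseteq> range E33_facet"
    by (auto simp: E33_facet_def E33_facets_def)
qed

text \<open>\<open>Q i j\<close> and \<open>R i j\<close> are, up to the cyclic shift by which an edge of a triangle is labelled by its
  first endpoint, the barycentric coordinates of the second component of \<open>V1 i\<close> and of the
  first component of \<open>V2 j\<close>. The last assumption says that these two points lie on a common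
  hyperplane through the product of edge \<open>i\<close> and edge \<open>j\<close>.\<close>

locale E33_configuration =
  fixes t \<tau> p s :: "3 \<Rightarrow> real" and Q R :: "3 \<Rightarrow> 3 \<Rightarrow> real"
  assumes pos: "0 < t i" "0 < \<tau> i" "0 < p i" "0 < s i" "0 < Q i j" "0 < R i j"
    and p_eq: "p i * (t i + 1 / t (i + 1) - 1) = 1"
    and s_eq: "s i * (\<tau> i + 1 / \<tau> (i + 1) - 1) = 1"
    and sum_Q: "sum (Q i) UNIV = 1"
    and sum_R: "(\<Sum>i\<in>UNIV. R i j) = 1"
    and QR: "Q i j * R i j = p i * s j"
begin

definition vert :: "E33_vertex \<Rightarrow> real ^ 4" where
  "vert k = (case k of
     V i j \<Rightarrow> pt (unit_coords i) (unit_coords j)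
   | V1 i \<Rightarrow> pt (circum t p i) (\<lambda>l. Q i (l + 1))
   | V2 j \<Rightarrow> pt (\<lambda>k. R (k + 1) j) (circum \<tau> s j))"

text \<open>The facet functionals. The one of \<open>V i j\<close> vanishes on the product of edge
  \<open>i\<close> and edge \<open>j\<close>, has its coefficients chosen to vanish at the vertex
  \<open>V1 i\<close>, and vanishes at \<open>V2 j\<close> by \<open>QR\<close>. The other two kinds
  are sides of the circumscribed triangles, lifted to \<open>real ^ 4\<close>.\<close>

definition func :: "E33_vertex \<Rightarrow> real ^ 4 \<Rightarrow> real" where
  "func f z = (case f of
     V i j \<Rightarrow> Q i j * lam (i - 1) z + p i * mu (j - 1) z
   | V1 i \<Rightarrow> lam (i + 1) z + t i * lam (i - 1) z
   | V2 j \<Rightarrow> mu (j + 1) z + \<tau> j * mu (j - 1) z)"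

lemma sum_shift: "(\<Sum>l\<in>UNIV. Q i (l + 1)) = 1" "(\<Sum>l\<in>UNIV. R (l + 1) j) = 1"
  using sum_Q[of i] sum_R[of j] by (simp_all add: sum_mod_3 three_simps)

lemma lam_vert:
  "lam k (vert (V i j)) = of_bool (k = i)"
  "lam k (vert (V1 i)) = circum t p i k"
  "lam k (vert (V2 j)) = R (k + 1) j"
  and mu_vert:
  "mu k (vert (V i j)) = of_bool (k = j)"
  "mu k (vert (V1 i)) = Q i (k + 1)"
  "mu k (vert (V2 j)) = circum \<tau> s j k"
  by (simp_all add: vert_def lam_pt mu_pt sum_unit_coords sum_circum p_eq s_eq sum_shift unit_coords_def)

lemma func_vert: "0 \<le> func f (vert k)" "func f (vert k) = 0 \<longleftrightarrow> k \<in> E33_facet f"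
proof -
  have "0 \<le> func f (vert k) \<and> (func f (vert k) = 0 \<longleftrightarrow> k \<in> E33_facet f)"
  proof (cases f)
    case f: (V i j)
    show ?thesis
    proof (cases k)
      case k: (V k l)
      have "V k l \<in> E33_facet f \<longleftrightarrow> k \<noteq> i - 1 \<and> l \<noteq> j - 1"
        unfolding cyclic_neq[symmetric] by (auto simp: f E33_facet_def)
      moreover have "func f (vert (V k l)) = of_bool (k = i - 1) * Q i j + of_bool (l = j - 1) * p i"
        by (auto simp: f k func_def lam_vert mu_vert)
      ultimately show ?thesis
        using pos(5)[of i j] pos(3)[of i] by (auto simp: k)
    next
      case k: (V1 k)
      show ?thesis
      proof (cases "k = i")
        case True
        then show ?thesis
          by (simp add: f k func_def lam_vert mu_vert E33_facet_def circum_def)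
      next
        case False
        then have "0 < circum t p k (i - 1)"
          using pos by (intro circum_pos) auto
        then have "0 < func f (vert (V1 k))"
          using pos by (simp add: f func_def lam_vert mu_vert add_pos_pos)
        then show ?thesis
          using False by (auto simp: f k E33_facet_def)
      qed
    next
      case k: (V2 l)
      show ?thesis
      proof (cases "l = j")
        case True
        then show ?thesis
          using QR[of i j] by (simp add: f k func_def lam_vert mu_vert E33_facet_def circum_def)
      next
        case False
        then have "0 < circum \<tau> s l (j - 1)"
          using pos by (intro circum_pos) auto
        then have "0 < func f (vert (V2 l))"
          using pos by (simp add: f func_def lam_vert mu_vert add_pos_pos)
        then show ?thesis
          using False by (auto simp: f k E33_facet_def)
      qed
    qed
  next
    case f: (V1 i)
    show ?thesis
    proof (cases k)
      case k: (V k l)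
      have "l = 0 \<or> l = 1 \<or> l = 2"
        by (rule exhaust_mod_3)
      then show ?thesis
        using eq_cyclic[of k i] pos(1)[of i] exhaust_mod_3[of i]
        by (auto simp: f k func_def lam_vert mu_vert E33_facet_def three_simps)
    next
      case k: (V1 k)
      show ?thesis
        using circum_line[of t p k i] pos by (auto simp: f k func_def lam_vert E33_facet_def)
    next
      case k: (V2 l)
      have "0 < func f (vert k)"
        using pos by (simp add: f k func_def lam_vert add_pos_pos)
      then show ?thesis
        by (auto simp: f k E33_facet_def)
    qed
  next
    case f: (V2 j)
    show ?thesis
    proof (cases k)
      case k: (V k l)
      have "k = 0 \<or> k = 1 \<or> k = 2"
        by (rule exhaust_mod_3)
      then show ?thesis
        using eq_cyclic[of l j] pos(2)[of j] exhaust_mod_3[of j]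
        by (auto simp: f k func_def lam_vert mu_vert E33_facet_def three_simps)
    next
      case k: (V2 k)
      show ?thesis
        using circum_line[of \<tau> s k j] pos by (auto simp: f k func_def mu_vert E33_facet_def)
    next
      case k: (V1 l)
      have "0 < func f (vert k)"
        using pos by (simp add: f k func_def mu_vert add_pos_pos)
      then show ?thesis
        by (auto simp: f k E33_facet_def)
    qed
  qed
  then show "0 \<le> func f (vert k)" "func f (vert k) = 0 \<longleftrightarrow> k \<in> E33_facet f"
    by blast+
qed

lemma func_affine: "func f ((1 - u) *\<^sub>R x + u *\<^sub>R y) = (1 - u) * func f x + u * func f y"
  by (cases f) (simp_all only: func_def E33_vertex.case lam_affine mu_affine, simp_all add: algebra_simps)

text \<open>If \<open>z\<close> lies beyond an edge of one triangle, remove from it the multiple of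
  the outer vertex \<open>V1 i\<close> or \<open>V2 j\<close> beyond that edge which cancels the
  negative coordinate. The facet inequalities say exactly that the other coordinates stay
  nonnegative.\<close>

lemma in_hull_if_func_nonneg:
  assumes z: "\<And>f. 0 \<le> func f z"
  shows "z \<in> convex hull (range vert)"
proof -
  have vert_hull: "vert k \<in> convex hull (range vert)" for k
    by (simp add: hull_inc)
  have prod_hull: "pt (unit_coords k) (unit_coords l) \<in> convex hull (range vert)" for k l
    using vert_hull[of "V k l"] by (simp add: vert_def)
  consider i where "lam (i - 1) z < 0" | j where "mu (j - 1) z < 0"
    | "\<And>k. 0 \<le> lam k z" "\<And>k. 0 \<le> mu k z"
    by (metis diff_add_cancel add_diff_cancel not_less)
  then show ?thesis
  proof cases
    case (1 i)
    have P: "0 \<le> lam (i + 1) z + t i * lam (i - 1) z" "0 \<le> Q i j * lam (i - 1) z + p i * mu (j - 1) z"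
      "0 \<le> lam (i - 1) z + t (i + 1) * lam i z" for j
      using z[of "V1 i"] z[of "V i j"] z[of "V1 (i + 1)"] by (simp_all add: func_def cyclic_simps)
    \<comment> \<open>\<open>V1 i\<close> has the coordinate \<open>- p i\<close> at index
      \<open>i - 1\<close>, so removing this multiple makes the negative coordinate vanish.\<close>
    define c where "c = - lam (i - 1) z / p i"
    show ?thesis
    proof (rule in_convex_if_cone[of c _ "vert (V1 i)"])
      show "0 \<le> c"
        using 1 pos(3)[of i] by (simp add: c_def divide_nonpos_pos)
      have cp: "c * p i = - lam (i - 1) z"
        using pos(3)[of i] by (simp add: c_def)
      show "0 \<le> lam k z - c * lam k (vert (V1 i))" for k
      proof -
        have "c * (t i * p i) = - t i * lam (i - 1) z" "c * (p i / t (i + 1)) = - lam (i - 1) z / t (i + 1)"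
          by (simp_all add: cp mult.left_commute[of c "t i" "p i"])
        moreover have "0 \<le> lam i z + lam (i - 1) z / t (i + 1)"
        proof -
          have "0 \<le> (lam (i - 1) z + t (i + 1) * lam i z) / t (i + 1)"
            using P(3) pos(1)[of "i + 1"] by simp
          then show ?thesis
            using pos(1)[of "i + 1"] by (simp add: field_simps)
        qed
        ultimately show ?thesis
          using eq_cyclic[of k i] P(1) cp by (auto simp: lam_vert circum_def)
      qed
      show "0 \<le> mu k z - c * mu k (vert (V1 i))" for k
      proof -
        have "p i * (mu k z - c * Q i (k + 1)) = p i * mu k z - (c * p i) * Q i (k + 1)"
          by (simp add: algebra_simps)
        also have "\<dots> \<ge> 0"
          using P(2)[of "k + 1"] by (simp add: cp algebra_simps)
        finally show ?thesis
          using pos(3)[of i] by (simp add: mu_vert zero_le_mult_iff)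
      qed
    qed (use vert_hull prod_hull in auto)
  next
    case (2 j)
    have P: "0 \<le> mu (j + 1) z + \<tau> j * mu (j - 1) z" "0 \<le> Q i j * lam (i - 1) z + p i * mu (j - 1) z"
      "0 \<le> mu (j - 1) z + \<tau> (j + 1) * mu j z" for i
      using z[of "V2 j"] z[of "V i j"] z[of "V2 (j + 1)"] by (simp_all add: func_def cyclic_simps)
    define c where "c = - mu (j - 1) z / s j"
    show ?thesis
    proof (rule in_convex_if_cone[of c _ "vert (V2 j)"])
      show "0 \<le> c"
        using 2 pos(4)[of j] by (simp add: c_def divide_nonpos_pos)
      have cp: "c * s j = - mu (j - 1) z"
        using pos(4)[of j] by (simp add: c_def)
      show "0 \<le> mu k z - c * mu k (vert (V2 j))" for k
      proof -
        have "c * (\<tau> j * s j) = - \<tau> j * mu (j - 1) z" "c * (s j / \<tau> (j + 1)) = - mu (j - 1) z / \<tau> (j + 1)"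
          by (simp_all add: cp mult.left_commute[of c "\<tau> j" "s j"])
        moreover have "0 \<le> mu j z + mu (j - 1) z / \<tau> (j + 1)"
        proof -
          have "0 \<le> (mu (j - 1) z + \<tau> (j + 1) * mu j z) / \<tau> (j + 1)"
            using P(3) pos(2)[of "j + 1"] by simp
          then show ?thesis
            using pos(2)[of "j + 1"] by (simp add: field_simps)
        qed
        ultimately show ?thesis
          using eq_cyclic[of k j] P(1) cp by (auto simp: mu_vert circum_def)
      qed
      show "0 \<le> lam k z - c * lam k (vert (V2 j))" for k
      proof -
        \<comment> \<open>The octahedron inequality is written with \<open>Q\<close> and
          \<open>p\<close>; multiplying by the positive \<open>Q (k + 1) j * s j\<close> lets
          \<open>QR\<close> eliminate \<open>R\<close>.\<close>
        have "(Q (k + 1) j * s j) * (lam k z - c * R (k + 1) j)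
            = s j * (Q (k + 1) j * lam k z) - (c * s j) * (Q (k + 1) j * R (k + 1) j)"
          by (simp add: algebra_simps)
        also have "\<dots> = s j * (Q (k + 1) j * lam (k + 1 - 1) z + p (k + 1) * mu (j - 1) z)"
          by (simp add: cp QR algebra_simps)
        also have "\<dots> \<ge> 0"
          using P(2)[of "k + 1"] pos(4)[of j] by simp
        finally show ?thesis
          using mult_pos_pos[OF pos(5)[of "k + 1" j] pos(4)[of j]]
          by (simp add: lam_vert zero_le_mult_iff)
      qed
    qed (use vert_hull prod_hull in auto)
  next
    case 3
    then show ?thesis
      by (rule in_convex_hull_products) (simp_all add: prod_hull)
  qed
qed

lemma lattice_isomorphic_E33:
  "lattice_isomorphic (face_lattice (convex hull (range vert))) E33_face_lattice"
proof -
  have "\<Inter>(range E33_facet) = {}"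
    using empty_in_E33_face_lattice by (auto simp: E33_face_lattice_def range_E33_facet)
  then show ?thesis
    using lattice_isomorphic_face_lattice[of func vert E33_facet] func_affine func_vert in_hull_if_func_nonneg
    by (simp add: E33_face_lattice_def range_E33_facet)
qed

end

section \<open>A nine-parameter family\<close>

text \<open>Reading the system as \<open>x = u - 1 / y\<close> and so on, \<open>x\<close> is a
  fixed point of a product of three Moebius maps of determinant 1, hence a root of a quadratic. The
  larger root is taken; the bounds 3 make it at least 1, and then \<open>z\<close> and
  \<open>y\<close> at least 2.\<close>

lemma periodic_root:
  fixes u v w :: real
  defines "a \<equiv> v * w - 1"
  defines "b \<equiv> u * a + v - w"
  assumes uvw: "3 \<le> u" "3 \<le> v" "3 \<le> w"
  defines "x \<equiv> (b + sqrt (b\<^sup>2 - 4 * a * (u * v - 1))) / (2 * a)"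
  defines "z \<equiv> w - 1 / x"
  defines "y \<equiv> v - 1 / z"
  shows "0 < a" "0 < x" "0 < y" "0 < z" "x + 1 / y = u" "y + 1 / z = v" "z + 1 / x = w"
proof -
  have vw: "9 \<le> v * w" "9 \<le> u * v"
    using mult_mono[of 3 v 3 w] mult_mono[of 3 u 3 v] uvw by auto
  then show a: "0 < a"
    by (simp add: a_def)
  have "3 * a \<le> u * a"
    using a uvw by simp
  moreover have "0 \<le> w * (v - 1) + v - 1"
    using uvw by (intro add_nonneg_nonneg[of "w * (v - 1)" "v - 1", simplified add_diff_eq] mult_nonneg_nonneg) auto
  ultimately have b: "2 * a \<le> b"
    by (simp add: b_def a_def algebra_simps)
  \<comment> \<open>This is the squared trace minus 4 for the product of the three matrices; the
    root is real once the trace is at least 2.\<close>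
  have disc: "b\<^sup>2 - 4 * a * (u * v - 1) = (u * v * w - u - v - w)\<^sup>2 - 4"
    by (simp add: a_def b_def power2_eq_square algebra_simps)
  have "2 \<le> u * v * w - u - v - w"
  proof -
    have uw: "9 \<le> u * w"
      using uvw mult_mono[of 3 u 3 w] by simp
    have "9 * u \<le> u * v * w"
      using mult_left_mono[OF vw(1), of u] uvw by (simp add: mult_ac)
    moreover have "9 * v \<le> u * v * w"
      using mult_left_mono[OF uw, of v] uvw by (simp add: mult_ac)
    moreover have "9 * w \<le> u * v * w"
      using mult_left_mono[OF vw(2), of w] uvw by (simp add: mult_ac)
    ultimately show ?thesis
      using uvw by linarith
  qed
  then have "2\<^sup>2 \<le> (u * v * w - u - v - w)\<^sup>2"
    by (rule power_mono) simp
  then have d: "0 \<le> b\<^sup>2 - 4 * a * (u * v - 1)"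
    by (simp add: disc)
  have x1: "1 \<le> x"
    using a b d by (simp add: x_def le_divide_eq real_sqrt_ge_zero add_increasing2)
  then show "0 < x"
    by simp
  have "1 / x \<le> 1"
    using x1 by simp
  then have z2: "2 \<le> z"
    using uvw by (simp add: z_def)
  then show "0 < z"
    by simp
  have "1 / z \<le> 1"
    using z2 by simp
  then have "2 \<le> y"
    using uvw by (simp add: y_def)
  then show "0 < y"
    by simp
  show "y + 1 / z = v" "z + 1 / x = w"
    by (simp_all add: y_def z_def)
  have "(2 * a * x - b)\<^sup>2 = b\<^sup>2 - 4 * a * (u * v - 1)"
    using a d by (simp add: x_def)
  then have "4 * a * (a * x\<^sup>2 - b * x + (u * v - 1)) = 0"
    by (simp add: power2_eq_square algebra_simps)
  then have q: "a * x\<^sup>2 - b * x + (u * v - 1) = 0"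
    using a by simp
  have zx: "z * x = w * x - 1"
    using \<open>0 < x\<close> by (simp add: z_def field_simps)
  have yz: "y * z = v * z - 1"
    using \<open>0 < z\<close> by (simp add: y_def field_simps)
  have "(u - x) * (y * z) * x = z * x"
  proof -
    have "(u - x) * (y * z) * x = (u - x) * (v * (z * x) - x)"
      by (simp add: yz algebra_simps)
    also have "\<dots> = (u - x) * (v * (w * x - 1) - x)"
      by (simp only: zx)
    also have "\<dots> = w * x - 1 - (a * x\<^sup>2 - b * x + (u * v - 1))"
      by (simp add: a_def b_def power2_eq_square algebra_simps)
    finally show ?thesis
      by (simp add: q zx)
  qed
  then have "((u - x) * y - 1) * (z * x) = 0"
    by (simp add: algebra_simps)
  then have "(u - x) * y = 1"
    using \<open>0 < x\<close> \<open>0 < z\<close> by simp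
  then show "x + 1 / y = u"
    using \<open>0 < y\<close> by (simp add: field_simps)
qed

text \<open>The nine parameters: the slopes \<open>t\<close> and the columns 1 and 2 of \<open>Q\<close>.\<close>

definition par_t :: "real ^ 3 ^ 3 \<Rightarrow> 3 \<Rightarrow> real" where
  "par_t x i = x $ 0 $ i"

definition par_Q :: "real ^ 3 ^ 3 \<Rightarrow> 3 \<Rightarrow> 3 \<Rightarrow> real" where
  "par_Q x i j = (if j = 0 then 1 - x $ 1 $ i - x $ 2 $ i else x $ j $ i)"

definition par_p :: "real ^ 3 ^ 3 \<Rightarrow> 3 \<Rightarrow> real" where
  "par_p x i = 1 / (par_t x i + 1 / par_t x (i + 1) - 1)"

text \<open>\<open>QR\<close> forces \<open>R i j = p i * s j / Q i j\<close>, and this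
  \<open>s j\<close> is the factor that makes column \<open>j\<close> of \<open>R\<close> sum to
  1.\<close>

definition par_s :: "real ^ 3 ^ 3 \<Rightarrow> 3 \<Rightarrow> real" where
  "par_s x j = 1 / (\<Sum>i\<in>UNIV. par_p x i / par_Q x i j)"

definition par_R :: "real ^ 3 ^ 3 \<Rightarrow> 3 \<Rightarrow> 3 \<Rightarrow> real" where
  "par_R x i j = par_p x i * par_s x j / par_Q x i j"

text \<open>This is \<open>1 + 1 / s j\<close>, the value that the normalisation \<open>s_eq\<close>
  prescribes for \<open>\<tau> j + 1 / \<tau> (j + 1)\<close>.\<close>

definition par_u :: "real ^ 3 ^ 3 \<Rightarrow> 3 \<Rightarrow> real" where
  "par_u x j = 1 + (\<Sum>i\<in>UNIV. par_p x i / par_Q x i j)"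

text \<open>\<open>\<tau>\<close> has to solve the cyclic system \<open>\<tau>\<^sub>j + 1 / \<tau>\<^bsub>j + 1\<^esub> = u\<^sub>j\<close>,
  which amounts to a quadratic equation for \<open>\<tau>\<^sub>0\<close>.\<close>

definition par_root :: "real ^ 3 ^ 3 \<Rightarrow> real" where
  "par_root x = (let u = par_u x 0; v = par_u x 1; w = par_u x 2; a = v * w - 1; b = u * a + v - w
     in (b + sqrt (b\<^sup>2 - 4 * a * (u * v - 1))) / (2 * a))"

definition par_tau :: "real ^ 3 ^ 3 \<Rightarrow> 3 \<Rightarrow> real" where
  "par_tau x j = (if j = 0 then par_root x
     else if j = 2 then par_u x 2 - 1 / par_root x
     else par_u x 1 - 1 / (par_u x 2 - 1 / par_root x))"

text \<open>The centre is the symmetric choice of slopes 2 and \<open>Q\<close> constantly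
  \<open>1 / 3\<close>. The radius is small enough that \<open>par_u\<close> is at least 3, as
  \<open>periodic_root\<close> demands.\<close>

definition par_ball :: "(real ^ 3 ^ 3) set" where
  "par_ball = ball (\<chi> i j. if i = 0 then 2 else 1 / 3) (1 / 12)"

lemma par_ball_bounds:
  assumes "x \<in> par_ball"
  shows "par_t x i \<in> {3/2..5/2}" "par_Q x i j \<in> {1/6..1/2}"
proof -
  define c :: "real ^ 3 ^ 3" where "c = (\<chi> i j. if i = 0 then 2 else 1 / 3)"
  have "\<bar>x $ k $ l - c $ k $ l\<bar> \<le> 1 / 12" for k l
  proof -
    have "\<bar>(x - c) $ k $ l\<bar> \<le> norm (x - c)"
      using component_le_norm_cart[of "(x - c) $ k" l] Finite_Cartesian_Product.norm_nth_le[of "x - c" k] by linarith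
    also have "\<dots> \<le> 1 / 12"
      using assms by (simp add: par_ball_def c_def dist_norm norm_minus_commute)
    finally show ?thesis
      by simp
  qed
  from this[of 0] this[of 1] this[of 2]
  have b: "\<bar>x $ 0 $ i - 2\<bar> \<le> 1 / 12" "\<bar>x $ 1 $ i - 1 / 3\<bar> \<le> 1 / 12" "\<bar>x $ 2 $ i - 1 / 3\<bar> \<le> 1 / 12" for i
    by (simp_all add: c_def)
  show "par_t x i \<in> {3/2..5/2}"
    using b(1)[of i, unfolded abs_le_iff] by (auto simp: par_t_def)
  have q: "1 / 4 \<le> x $ 1 $ i" "x $ 1 $ i \<le> 5 / 12" "1 / 4 \<le> x $ 2 $ i" "x $ 2 $ i \<le> 5 / 12"
    using b(2)[of i] b(3)[of i] unfolding abs_le_iff by linarith+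
  have "par_Q x i 0 = 1 - x $ 1 $ i - x $ 2 $ i" "par_Q x i 1 = x $ 1 $ i" "par_Q x i 2 = x $ 2 $ i"
    by (simp_all add: par_Q_def)
  then have "1 / 6 \<le> par_Q x i j" "par_Q x i j \<le> 1 / 2"
    using exhaust_mod_3[of j] q by (elim disjE; hypsubst; linarith)+
  then show "par_Q x i j \<in> {1/6..1/2}"
    by simp
qed

lemma par_p_bounds:
  assumes "x \<in> par_ball"
  shows "6 / 13 \<le> par_p x i" "0 < par_t x i + 1 / par_t x (i + 1) - 1"
proof -
  have t: "3 / 2 \<le> par_t x i" "par_t x i \<le> 5 / 2" for i
    using par_ball_bounds(1)[OF assms, of i] by auto
  have "0 < 1 / par_t x (i + 1)" "1 / par_t x (i + 1) \<le> 2 / 3"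
    using t(1)[of "i + 1"] by (auto simp: divide_le_eq)
  then have "0 < par_t x i + 1 / par_t x (i + 1) - 1" "par_t x i + 1 / par_t x (i + 1) - 1 \<le> 13 / 6"
    using t[of i] by linarith+
  then show "6 / 13 \<le> par_p x i" "0 < par_t x i + 1 / par_t x (i + 1) - 1"
    by (simp_all add: par_p_def le_divide_eq)
qed

lemma par_u_ge:
  assumes "x \<in> par_ball"
  shows "3 \<le> par_u x j"
proof -
  \<comment> \<open>The lower bound \<open>6 / 13\<close> is divided by the upper bound
    \<open>1 / 2\<close>; three such summands exceed 2.\<close>
  have "12 / 13 \<le> par_p x i / par_Q x i j" for i
    using par_p_bounds(1)[OF assms, of i] par_ball_bounds(2)[OF assms, of i j]
      frac_le[of "par_p x i" "6/13" "par_Q x i j" "1/2"] by auto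
  then have "(\<Sum>i\<in>(UNIV :: 3 set). 12 / 13) \<le> (\<Sum>i\<in>UNIV. par_p x i / par_Q x i j)"
    by (intro sum_mono) auto
  then show ?thesis
    by (simp add: par_u_def)
qed

lemma par_tau:
  assumes "x \<in> par_ball"
  shows "0 < par_tau x j" "par_tau x j + 1 / par_tau x (j + 1) = par_u x j"
proof -
  note r = periodic_root[OF par_u_ge[OF assms, of 0] par_u_ge[OF assms, of 1] par_u_ge[OF assms, of 2]]
  have "par_tau x 0 > 0 \<and> par_tau x 1 > 0 \<and> par_tau x 2 > 0"
    using r(2-4) by (simp add: par_tau_def par_root_def Let_def)
  then show "0 < par_tau x j"
    using exhaust_mod_3[of j] by auto
  have "par_tau x 0 + 1 / par_tau x 1 = par_u x 0" "par_tau x 1 + 1 / par_tau x 2 = par_u x 1"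
    "par_tau x 2 + 1 / par_tau x 0 = par_u x 2"
    using r(5-7) by (simp_all add: par_tau_def par_root_def Let_def)
  then show "par_tau x j + 1 / par_tau x (j + 1) = par_u x j"
    using exhaust_mod_3[of j] by (auto simp: three_simps)
qed

lemma E33_configuration_par:
  assumes x: "x \<in> par_ball"
  shows "E33_configuration (par_t x) (par_tau x) (par_p x) (par_s x) (par_Q x) (par_R x)"
proof
  have p: "0 < par_p x i" for i
    using par_p_bounds(1)[OF x, of i] by linarith
  have Q: "0 < par_Q x i j" for i j
    using par_ball_bounds(2)[OF x, of i j] by auto
  have u: "par_s x j = 1 / (par_u x j - 1)" "0 < par_u x j - 1" for j
    using par_u_ge[OF x, of j] by (simp_all add: par_s_def par_u_def)
  then have s: "0 < par_s x j" for j
    by simp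
  show "0 < par_t x i" "0 < par_tau x i" "0 < par_p x i" "0 < par_s x i" "0 < par_Q x i j" "0 < par_R x i j" for i j
    using par_ball_bounds(1)[OF x, of i] par_tau(1)[OF x] p Q s by (auto simp: par_R_def)
  show "par_p x i * (par_t x i + 1 / par_t x (i + 1) - 1) = 1" for i
    using par_p_bounds(2)[OF x, of i] by (simp add: par_p_def)
  show "par_s x i * (par_tau x i + 1 / par_tau x (i + 1) - 1) = 1" for i
    using u[of i] by (simp add: par_tau(2)[OF x])
  show "sum (par_Q x i) UNIV = 1" for i
    by (simp add: sum_mod_3 par_Q_def)
  show "(\<Sum>i\<in>UNIV. par_R x i j) = 1" for j
  proof -
    have "(\<Sum>i\<in>UNIV. par_R x i j) = par_s x j * (\<Sum>i\<in>UNIV. par_p x i / par_Q x i j)"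
      by (simp add: par_R_def sum_distrib_left mult.commute)
    also have "\<dots> = 1"
      using u[of j] by (simp add: par_u_def)
    finally show ?thesis .
  qed
  show "par_Q x i j * par_R x i j = par_p x i * par_s x j" for i j
    using Q[of i j] by (simp add: par_R_def)
qed

section \<open>Injectivity and continuity of the family\<close>

definition par_vert :: "real ^ 3 ^ 3 \<Rightarrow> E33_vertex \<Rightarrow> real ^ 4" where
  "par_vert x = E33_configuration.vert (par_t x) (par_tau x) (par_p x) (par_s x) (par_Q x) (par_R x)"

text \<open>The vertices \<open>V1 i\<close> alone recover the parameters: their second components
  are the rows of \<open>Q\<close>, and their first components contain \<open>- p i\<close> and
  \<open>t i * p i\<close>.\<close>

lemma par_vert_inject:
  assumes x: "x \<in> par_ball" and y: "y \<in> par_ball" and eq: "par_vert x = par_vert y"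
  shows "x = y"
proof -
  interpret x: E33_configuration "par_t x" "par_tau x" "par_p x" "par_s x" "par_Q x" "par_R x"
    using x by (rule E33_configuration_par)
  interpret y: E33_configuration "par_t y" "par_tau y" "par_p y" "par_s y" "par_Q y" "par_R y"
    using y by (rule E33_configuration_par)
  have eq: "x.vert = y.vert"
    using eq unfolding par_vert_def .
  have Q: "par_Q x i (k + 1) = par_Q y i (k + 1)" for i k
    using x.mu_vert(2)[of k i] y.mu_vert(2)[of k i] unfolding eq by (rule trans[OF sym])
  have c: "circum (par_t x) (par_p x) i k = circum (par_t y) (par_p y) i k" for i k
    using x.lam_vert(2)[of k i] y.lam_vert(2)[of k i] unfolding eq by (rule trans[OF sym])
  have p: "par_p x i = par_p y i" for i
    using c[of i "i - 1"] by (simp add: circum_simps)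
  have t: "par_t x i = par_t y i" for i
    using c[of i "i + 1"] x.pos(3)[of i] by (simp add: circum_simps p)
  have "x $ k $ i = y $ k $ i" for k i
    using exhaust_mod_3[of k] t[of i] Q[of i 0] Q[of i 1] by (auto simp: par_t_def par_Q_def)
  then show ?thesis
    by (simp add: vec_eq_iff)
qed

lemma continuous_on_par_vert: "continuous_on par_ball (\<lambda>x. par_vert x k)"
proof -
  have ct: "continuous_on par_ball (\<lambda>x. par_t x i)" for i
    unfolding par_t_def by (intro continuous_intros)
  have cQ: "continuous_on par_ball (\<lambda>x. par_Q x i j)" for i j
    unfolding par_Q_def by (cases "j = 0") (auto intro!: continuous_intros)
  have t0: "par_t x i \<noteq> 0" "par_t x i + 1 / par_t x (i + 1) - 1 \<noteq> 0" if "x \<in> par_ball" for x i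
    using par_ball_bounds(1)[OF that, of i] par_p_bounds(2)[OF that, of i] by auto
  have cp: "continuous_on par_ball (\<lambda>x. par_p x i)" for i
    unfolding par_p_def using t0 by (intro continuous_intros ct) auto
  have Q0: "par_Q x i j \<noteq> 0" if "x \<in> par_ball" for x i j
    using par_ball_bounds(2)[OF that, of i j] by auto
  have cu: "continuous_on par_ball (\<lambda>x. par_u x j)" for j
    unfolding par_u_def using Q0 by (intro continuous_intros cp cQ) auto
  have s_eq: "par_s x j = 1 / (par_u x j - 1)" for x j
    by (simp add: par_s_def par_u_def)
  have cs: "continuous_on par_ball (\<lambda>x. par_s x j)" for j
    unfolding s_eq using par_u_ge[of _ j] by (intro continuous_intros cu) force
  have cR: "continuous_on par_ball (\<lambda>x. par_R x i j)" for i j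
    unfolding par_R_def using Q0 by (intro continuous_intros cp cs cQ) auto
  have a0: "par_u x 1 * par_u x 2 - 1 \<noteq> 0" if "x \<in> par_ball" for x
    using periodic_root(1)[OF par_u_ge[OF that, of 0] par_u_ge[OF that, of 1] par_u_ge[OF that, of 2]] by simp
  have croot: "continuous_on par_ball par_root"
    unfolding par_root_def Let_def using a0 by (intro continuous_intros cu) auto
  have tau0: "par_root x \<noteq> 0" "par_u x 2 - 1 / par_root x \<noteq> 0" if "x \<in> par_ball" for x
    using par_tau(1)[OF that, of 0] par_tau(1)[OF that, of 2] by (simp_all add: par_tau_def)
  have ctau: "continuous_on par_ball (\<lambda>x. par_tau x j)" for j
    using exhaust_mod_3[of j] tau0 by (auto simp: par_tau_def intro!: continuous_intros cu croot)
  have tau_nz: "par_tau x j \<noteq> 0" if "x \<in> par_ball" for x j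
    using par_tau(1)[OF that, of j] by simp
  have ccirc: "continuous_on par_ball (\<lambda>x. circum (par_t x) (par_p x) i k)"
    "continuous_on par_ball (\<lambda>x. circum (par_tau x) (par_s x) i k)" for i k
    unfolding circum_def using t0 tau_nz
    by (cases "k = i - 1"; cases "k = i + 1"; auto intro!: continuous_intros ct cp ctau cs)+
  have cpt: "continuous_on par_ball (\<lambda>x. pt (a x) (b x))"
    if a: "\<And>k. continuous_on par_ball (\<lambda>x. a x k)" and b: "\<And>k. continuous_on par_ball (\<lambda>x. b x k)"
    for a b :: "real ^ 3 ^ 3 \<Rightarrow> 3 \<Rightarrow> real"
  proof -
    have "continuous_on par_ball (\<lambda>x. if i = 1 then a x 1 else if i = 2 then a x 2 else if i = 3 then b x 1 else b x 2)"
      for i :: 4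
      using a b by (cases "i = 1"; cases "i = 2"; cases "i = 3"; simp)
    then show ?thesis
      unfolding pt_def by (intro continuous_on_vec_lambda)
  qed
  have "continuous_on par_ball (\<lambda>x. case k of
     V i j \<Rightarrow> pt (unit_coords i) (unit_coords j)
   | V1 i \<Rightarrow> pt (circum (par_t x) (par_p x) i) (\<lambda>l. par_Q x i (l + 1))
   | V2 j \<Rightarrow> pt (\<lambda>k. par_R x (k + 1) j) (circum (par_tau x) (par_s x) j))"
    by (cases k) (auto intro!: cpt ccirc cQ cR)
  then show ?thesis
    by (rule continuous_on_eq) (simp add: par_vert_def E33_configuration.vert_def[OF E33_configuration_par])
qed

section \<open>Labelled projective equivalence\<close>

text \<open>Positive weights \<open>g\<close> express that the hyperplane sent to infinity misses
  the convex hull. The equations for \<open>L\<close> and \<open>g\<close> survive limits;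
  positivity and bijectivity have to be recovered there.\<close>

definition labelled_equivalent ::
  "('n \<Rightarrow> 'k) \<Rightarrow> ('k \<Rightarrow> 'a::euclidean_space) \<Rightarrow> ('n \<Rightarrow> 'a) \<Rightarrow> bool" where
  "labelled_equivalent \<rho> x y \<longleftrightarrow>
     (\<exists>(L :: 'a \<times> real \<Rightarrow> 'a \<times> real) g. linear L \<and> bij L \<and> (\<forall>j. 0 < g j \<and> L (x (\<rho> j), 1) = g j *\<^sub>R (y j, 1 :: real)))"

lemma labelled_equivalentE:
  assumes "labelled_equivalent \<rho> x y"
  obtains L g where "linear L" "bij L" "\<And>j. 0 < g j"
    "\<And>j. L (x (\<rho> j), 1 :: real) = g j *\<^sub>R (y j, 1 :: real)"
  using assms unfolding labelled_equivalent_def by blast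

lemma linear_bij_inv: "linear L \<Longrightarrow> bij L \<Longrightarrow> linear (inv L) \<and> bij (inv L)"
  for L :: "'a::euclidean_space \<Rightarrow> 'a"
  using bij_is_inj bij_imp_bij_inv inj_linear_imp_inv_linear by blast

lemma labelled_equivalent_inv:
  assumes "labelled_equivalent \<rho> x y" "bij \<rho>"
  shows "labelled_equivalent (inv \<rho>) y x"
proof -
  obtain L g where L: "linear L" "bij L" "\<And>j. 0 < g j" "\<And>j. L (x (\<rho> j), 1 :: real) = g j *\<^sub>R (y j, 1 :: real)"
    using assms(1) by (rule labelled_equivalentE) blast
  have "inv L (y (inv \<rho> k), 1) = (1 / g (inv \<rho> k)) *\<^sub>R (x k, 1)" for k
  proof -
    have "L (x k, 1) = g (inv \<rho> k) *\<^sub>R (y (inv \<rho> k), 1)"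
      using L(4)[of "inv \<rho> k"] assms(2) by (simp add: bij_is_surj surj_f_inv_f)
    then have "L ((1 / g (inv \<rho> k)) *\<^sub>R (x k, 1)) = (y (inv \<rho> k), 1)"
      using L(3)[of "inv \<rho> k"] by (simp add: linear_cmul[OF L(1)] del: scaleR_Pair)
    then show ?thesis
      using L(2) by (metis bij_inv_eq_iff)
  qed
  then show ?thesis
    unfolding labelled_equivalent_def using linear_bij_inv[OF L(1,2)] L(3)
    by (intro exI[of _ "inv L"] exI[of _ "\<lambda>k. 1 / g (inv \<rho> k)"]) simp
qed

text \<open>Composing the first equivalence with the inverse of the second cancels the
  relabelling.\<close>

lemma labelled_equivalent_left_unique:
  assumes "labelled_equivalent \<rho> x y" "labelled_equivalent \<rho> x' y" "bij \<rho>"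
  shows "labelled_equivalent id x x'"
proof -
  obtain L g where L: "linear L" "bij L" "\<And>j. 0 < g j" "\<And>j. L (x (\<rho> j), 1 :: real) = g j *\<^sub>R (y j, 1 :: real)"
    using assms(1) by (rule labelled_equivalentE) blast
  obtain M h where M: "linear M" "bij M" "\<And>j. 0 < h j" "\<And>j. M (y (inv \<rho> j), 1 :: real) = h j *\<^sub>R (x' j, 1 :: real)"
    using labelled_equivalent_inv[OF assms(2,3)] by (rule labelled_equivalentE) blast
  have "(M \<circ> L) (x k, 1) = (g (inv \<rho> k) * h k) *\<^sub>R (x' k, 1)" for k
    using L(4)[of "inv \<rho> k"] M(4)[of k] assms(3)
    by (simp add: bij_is_surj surj_f_inv_f linear_cmul[OF M(1)] del: scaleR_Pair)
  then show ?thesis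
    unfolding labelled_equivalent_def using L(1-3) M(1-3)
    by (intro exI[of _ "M \<circ> L"] exI[of _ "\<lambda>k. g (inv \<rho> k) * h k"]) (simp add: linear_compose bij_comp)
qed

text \<open>In homogeneous coordinates a convex combination maps to a combination of the images with
  nonnegative weights \<open>a\<close> and \<open>b\<close>, not both zero; dividing by
  \<open>a + b\<close> makes it convex again.\<close>

lemma projective_map_preserves_convex:
  assumes L: "linear L" and K: "convex K"
  shows "convex {p. 0 < snd (L (p, 1)) \<and> projective_map L p \<in> K}"
  unfolding convex_alt
proof (intro ballI allI impI)
  fix p q and u :: real
  assume p: "p \<in> {p. 0 < snd (L (p, 1)) \<and> projective_map L p \<in> K}"
    and q: "q \<in> {p. 0 < snd (L (p, 1)) \<and> projective_map L p \<in> K}" and u: "0 \<le> u \<and> u \<le> 1"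
  define r where "r = (1 - u) *\<^sub>R p + u *\<^sub>R q"
  define a b where "a = (1 - u) * snd (L (p, 1))" and "b = u * snd (L (q, 1))"
  have "(r, 1) = (1 - u) *\<^sub>R (p, 1) + u *\<^sub>R (q, 1 :: real)"
    by (simp add: r_def)
  then have "L (r, 1) = (1 - u) *\<^sub>R L (p, 1) + u *\<^sub>R L (q, 1)"
    by (simp only: linear_add[OF L] linear_cmul[OF L])
  moreover have "L (p, 1) = snd (L (p, 1)) *\<^sub>R (projective_map L p, 1)"
    "L (q, 1) = snd (L (q, 1)) *\<^sub>R (projective_map L q, 1)"
    using p q by (intro linear_projective_map[OF L]; simp)+
  ultimately have Lr: "L (r, 1) = a *\<^sub>R (projective_map L p, 1) + b *\<^sub>R (projective_map L q, 1)"
    unfolding a_def b_def by (metis scaleR_scaleR)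
  have ab: "0 \<le> a" "0 \<le> b" "0 < a + b"
  proof -
    show "0 \<le> a" "0 \<le> b"
      using p q u by (simp_all add: a_def b_def)
    show "0 < a + b"
      unfolding a_def b_def using p q u
      by (cases "u = 1") (auto intro!: add_pos_nonneg mult_pos_pos)
  qed
  have "projective_map L r = (a / (a + b)) *\<^sub>R projective_map L p + (b / (a + b)) *\<^sub>R projective_map L q"
    by (simp add: projective_map_def[of L r] Lr scaleR_add_right divide_inverse mult.commute)
  then have "projective_map L r \<in> K"
    using convexD[OF K, of "projective_map L p" "projective_map L q" "a / (a + b)" "b / (a + b)"] p q ab
    by (simp add: add_divide_distrib[symmetric])
  then show "(1 - u) *\<^sub>R p + u *\<^sub>R q \<in> {p. 0 < snd (L (p, 1)) \<and> projective_map L p \<in> K}"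
    using ab(3) by (simp add: r_def[symmetric] Lr)
qed

lemma labelled_equivalent_hull:
  fixes x :: "'k \<Rightarrow> 'a::euclidean_space"
  assumes L: "linear L" "\<And>j. 0 < g j" "\<And>j. L (x (\<rho> j), 1) = g j *\<^sub>R (y j, 1 :: real)" and \<rho>: "bij \<rho>"
    and p: "p \<in> convex hull (range x)"
  shows "0 < snd (L (p, 1))" "projective_map L p \<in> convex hull (range y)"
proof -
  have "x k \<in> {p. 0 < snd (L (p, 1)) \<and> projective_map L p \<in> convex hull (range y)}" for k
  proof -
    have "L (x k, 1) = g (inv \<rho> k) *\<^sub>R (y (inv \<rho> k), 1)"
      using L(3)[of "inv \<rho> k"] \<rho> by (simp add: bij_is_surj surj_f_inv_f)
    then show ?thesis
      using L(2)[of "inv \<rho> k"] by (simp add: projective_map_def hull_inc)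
  qed
  then have "convex hull (range x) \<subseteq> {p. 0 < snd (L (p, 1)) \<and> projective_map L p \<in> convex hull (range y)}"
    by (intro hull_minimal projective_map_preserves_convex L) auto
  then show "0 < snd (L (p, 1))" "projective_map L p \<in> convex hull (range y)"
    using p by auto
qed

lemma projectively_equivalent_if_labelled:
  fixes x :: "'k \<Rightarrow> 'a::euclidean_space"
  assumes xy: "labelled_equivalent \<rho> x y" and \<rho>: "bij \<rho>"
  shows "projectively_equivalent (convex hull (range x)) (convex hull (range y))"
proof -
  obtain L g where L: "linear L" "bij L" "\<And>j. 0 < g j" "\<And>j. L (x (\<rho> j), 1 :: real) = g j *\<^sub>R (y j, 1 :: real)"
    using xy by (rule labelled_equivalentE) blast
  define h where "h k = 1 / g (inv \<rho> k)" for k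
  have inv: "linear (inv L)" "\<And>k. 0 < h k"
    using linear_bij_inv[OF L(1,2)] L(3) by (auto simp: h_def)
  have Linv: "inv L (y (inv \<rho> k), 1) = h k *\<^sub>R (x k, 1)" for k
  proof -
    have "L (x k, 1) = g (inv \<rho> k) *\<^sub>R (y (inv \<rho> k), 1)"
      using L(4)[of "inv \<rho> k"] \<rho> by (simp add: bij_is_surj surj_f_inv_f)
    then have "L (h k *\<^sub>R (x k, 1)) = (y (inv \<rho> k), 1)"
      using L(3)[of "inv \<rho> k"] by (simp add: h_def linear_cmul[OF L(1)] del: scaleR_Pair)
    then show ?thesis
      using L(2) by (metis bij_inv_eq_iff)
  qed
  have "q \<in> projective_map L ` (convex hull (range x))" if q: "q \<in> convex hull (range y)" for q
  proof -
    let ?p = "projective_map (inv L) q"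
    note inv_hull = labelled_equivalent_hull[OF inv Linv bij_imp_bij_inv[OF \<rho>] q]
    define c where "c = snd (inv L (q, 1))"
    have c: "0 < c"
      using inv_hull(1) by (simp add: c_def)
    have "inv L (q, 1) = c *\<^sub>R (?p, 1)"
      unfolding c_def by (rule linear_projective_map[OF inv(1)]) (use inv_hull(1) in simp)
    then have "(q, 1) = L (c *\<^sub>R (?p, 1))"
      using L(2) by (metis bij_inv_eq_iff)
    also have "\<dots> = c *\<^sub>R L (?p, 1)"
      by (rule linear_cmul[OF L(1)])
    finally have "L (?p, 1) = (1 / c) *\<^sub>R (q, 1)"
      using c by (simp del: scaleR_Pair)
    then have "projective_map L ?p = q"
      using c by (simp add: projective_map_def)
    then show ?thesis
      using inv_hull(2) by (metis image_eqI)
  qed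
  then have "projective_map L ` (convex hull (range x)) = convex hull (range y)"
    using labelled_equivalent_hull(2)[where L = L and g = g and x = x and \<rho> = \<rho> and y = y, OF L(1,3,4) \<rho>] by blast
  then show ?thesis
    unfolding projectively_equivalent_def
    using L(1,2) labelled_equivalent_hull(1)[where L = L and g = g and x = x and \<rho> = \<rho> and y = y, OF L(1,3,4) \<rho>] by (metis less_irrefl)
qed

text \<open>The denominator has no zero on the connected hull, so it has constant sign, and a change
  of sign of \<open>M\<close> makes it positive. Then the images of the \<open>x k\<close> span the
  second hull and so include its extreme points \<open>y j\<close>; by counting, the resulting
  choice \<open>\<rho>\<close> is a bijection.\<close>

lemma labelled_if_projectively_equivalent:
  fixes x :: "'k::finite \<Rightarrow> 'a::euclidean_space" and y :: "'n::finite \<Rightarrow> 'a"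
  assumes xy: "projectively_equivalent (convex hull (range x)) (convex hull (range y))"
    and card: "CARD('k) = CARD('n)"
    and y: "inj y" "\<And>j. y j extreme_point_of convex hull (range y)"
  obtains \<rho> where "bij \<rho>" "labelled_equivalent \<rho> x y"
proof -
  define P where "P = convex hull (range x)"
  obtain M where M: "linear M" "bij M" "\<And>p. p \<in> P \<Longrightarrow> snd (M (p, 1)) \<noteq> 0"
    "projective_map M ` P = convex hull (range y)"
    using xy by (auto simp: projectively_equivalent_def P_def)
  obtain L where L: "linear L" "bij L" "\<And>p. p \<in> P \<Longrightarrow> 0 < snd (L (p, 1))"
    "projective_map L ` P = convex hull (range y)"
  proof -
    have "continuous_on P (\<lambda>p. M (p, 1))"
      using linear_continuous_on[OF linear_conv_bounded_linear[THEN iffD1, OF M(1)]]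
      by (rule continuous_on_compose2) (auto intro!: continuous_intros)
    then have "connected ((\<lambda>p. snd (M (p, 1))) ` P)"
      by (intro connected_continuous_image continuous_intros convex_connected)
        (simp_all add: P_def)
    then have "(\<forall>p\<in>P. 0 < snd (M (p, 1))) \<or> (\<forall>p\<in>P. snd (M (p, 1)) < 0)"
      using connectedD_interval[of "(\<lambda>p. snd (M (p, 1))) ` P" _ _ 0] M(3)
      by (metis (no_types, lifting) image_iff linorder_neqE_linordered_idom less_imp_le)
    then show thesis
    proof
      assume "\<forall>p\<in>P. 0 < snd (M (p, 1))"
      then show thesis
        using M that by blast
    next
      assume neg: "\<forall>p\<in>P. snd (M (p, 1)) < 0"
      have "linear (\<lambda>z. - M z)"
        using M(1) by (rule linear_compose_neg)
      moreover have "bij (\<lambda>z. - M z)"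
        using bij_comp[OF M(2) bij_uminus] by (simp add: comp_def)
      moreover have "projective_map (\<lambda>z. - M z) = projective_map M"
        by (simp add: fun_eq_iff projective_map_def)
      ultimately show thesis
        using neg M(4) by (intro that[of "\<lambda>z. - M z"]) auto
    qed
  qed
  have Lx: "L (x k, 1) = snd (L (x k, 1)) *\<^sub>R (projective_map L (x k), 1)" for k
    using L(3)[of "x k"] by (intro linear_projective_map[OF L(1)]) (auto simp: P_def hull_inc)
  let ?S = "range (\<lambda>k. projective_map L (x k))"
  have "P \<subseteq> {p. 0 < snd (L (p, 1)) \<and> projective_map L p \<in> convex hull ?S}"
    unfolding P_def using L(3)
    by (intro hull_minimal projective_map_preserves_convex L(1)) (auto simp: P_def hull_inc)
  then have "convex hull (range y) \<subseteq> convex hull ?S"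
    unfolding L(4)[symmetric] by blast
  moreover have "?S \<subseteq> convex hull (range y)"
    using L(4) by (auto simp: P_def hull_inc)
  ultimately have "convex hull ?S = convex hull (range y)"
    by (metis convex_convex_hull hull_minimal subset_antisym)
  then have "y j extreme_point_of convex hull ?S" for j
    using y(2)[of j] by simp
  then have "y j \<in> ?S" for j
    by (rule extreme_point_of_convex_hull)
  then have "\<forall>j. \<exists>k. y j = projective_map L (x k)"
    by blast
  then obtain \<rho> where \<rho>: "\<And>j. y j = projective_map L (x (\<rho> j))"
    by metis
  have "inj \<rho>"
    by (rule injI) (metis \<rho> y(1) injD)
  then have "bij \<rho>"
    using card card_image[of \<rho> UNIV] card_subset_eq[of UNIV "range \<rho>"] by (simp add: bij_def)
  moreover have "labelled_equivalent \<rho> x y"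
    unfolding labelled_equivalent_def
  proof (intro exI conjI allI)
    show "0 < snd (L (x (\<rho> j), 1))" for j
      by (rule L(3)) (simp add: P_def hull_inc)
    show "L (x (\<rho> j), 1) = snd (L (x (\<rho> j), 1)) *\<^sub>R (y j, 1)" for j
      unfolding \<rho> by (rule Lx)
  qed (fact L(1), fact L(2))
  ultimately show ?thesis
    using that by blast
qed

section \<open>Limits of projective equivalences\<close>

abbreviation frame_pt :: "3 \<Rightarrow> 3 \<Rightarrow> (real ^ 4) \<times> real" where
  "frame_pt k l \<equiv> (pt (unit_coords k) (unit_coords l), 1)"

text \<open>The linear map with prescribed values at the five product vertices \<open>(0,0)\<close>,
  \<open>(1,0)\<close>, \<open>(2,0)\<close>, \<open>(0,1)\<close>, \<open>(0,2)\<close>, whose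
  lifts form a basis of homogeneous coordinates.\<close>

definition frame_map :: "(3 \<Rightarrow> 3 \<Rightarrow> 'a::real_vector) \<Rightarrow> (real ^ 4) \<times> real \<Rightarrow> 'a" where
  "frame_map A z = snd z *\<^sub>R A 0 0 + (fst z $ 1) *\<^sub>R (A 1 0 - A 0 0) + (fst z $ 2) *\<^sub>R (A 2 0 - A 0 0)
     + (fst z $ 3) *\<^sub>R (A 0 1 - A 0 0) + (fst z $ 4) *\<^sub>R (A 0 2 - A 0 0)"

lemma linear_frame_map: "linear (frame_map A)"
  by (intro linearI) (simp_all add: frame_map_def algebra_simps)

lemma frame_map_frame_pt: "frame_map frame_pt z = z"
proof (rule prod_eqI)
  show "fst (frame_map frame_pt z) = fst z"
    by (simp add: frame_map_def vec_eq_iff forall_4 pt_def unit_coords_def)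
qed (simp add: frame_map_def)

lemma linear_eq_frame_map:
  assumes "linear L"
  shows "L z = frame_map (\<lambda>k l. L (frame_pt k l)) z"
proof -
  have "L z = L (frame_map frame_pt z)"
    by (simp only: frame_map_frame_pt)
  then show ?thesis
    by (simp only: frame_map_def linear_add[OF assms] linear_diff[OF assms] linear_cmul[OF assms])
qed

lemma tendsto_frame_map:
  fixes A :: "nat \<Rightarrow> 3 \<Rightarrow> 3 \<Rightarrow> 'a::real_normed_vector"
  assumes "\<And>k l. (\<lambda>n. A n k l) \<longlonglongrightarrow> B k l" "z \<longlonglongrightarrow> w"
  shows "(\<lambda>n. frame_map (A n) (z n)) \<longlonglongrightarrow> frame_map B w"
proof -
  have "(\<lambda>n. fst (z n) $ i) \<longlonglongrightarrow> fst w $ i" for i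
    using assms(2) by (intro tendsto_vec_nth tendsto_fst)
  moreover have "(\<lambda>n. snd (z n)) \<longlonglongrightarrow> snd w"
    using assms(2) by (rule tendsto_snd)
  ultimately show ?thesis
    unfolding frame_map_def by (intro tendsto_add tendsto_scaleR tendsto_diff assms(1))
qed

text \<open>Two vertices of each triangle give four product vertices that form a parallelogram, a
  linear relation between their lifts.\<close>

lemma frame_square:
  assumes "linear L"
  shows "L (frame_pt k l) + L (frame_pt k' l') = L (frame_pt k l') + L (frame_pt k' l)"
proof -
  have "frame_pt k l + frame_pt k' l' = frame_pt k l' + frame_pt k' l"
    by (simp add: vec_eq_iff forall_4 pt_def)
  then show ?thesis
    by (metis linear_add[OF assms])
qed

text \<open>Comparing coordinates in the parallelogram relation forces the eigenvalues at all
  product vertices to agree, and the frame spans.\<close>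

lemma frame_rigid:
  assumes L: "linear L" and A: "\<And>k l. L (frame_pt k l) = a k l *\<^sub>R frame_pt k l"
  shows "L z = a 0 0 *\<^sub>R z"
proof -
  have eq: "a k l = a 0 0" for k l
  proof -
    have main: "a k l = a 0 0 \<and> a k 0 = a 0 0 \<and> a 0 l = a 0 0" if "k \<noteq> 0" "l \<noteq> 0" for k l
    proof -
      have sq: "a 0 0 *\<^sub>R frame_pt 0 0 + a k l *\<^sub>R frame_pt k l = a 0 l *\<^sub>R frame_pt 0 l + a k 0 *\<^sub>R frame_pt k 0"
        using frame_square[OF L, of 0 0 k l] by (simp only: A)
      have "a 0 0 + a k l = a 0 l + a k 0"
        using arg_cong[OF sq, of snd] by simp
      moreover have "a k l = a k 0"
      proof -
        have "k = 1 \<or> k = 2"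
          using that(1) exhaust_mod_3[of k] by auto
        then show ?thesis
          using arg_cong[OF sq, of "\<lambda>z. fst z $ 1"] arg_cong[OF sq, of "\<lambda>z. fst z $ 2"]
          by (elim disjE) (simp_all add: pt_def unit_coords_def)
      qed
      moreover have "a k l = a 0 l"
      proof -
        have "l = 1 \<or> l = 2"
          using that(2) exhaust_mod_3[of l] by auto
        then show ?thesis
          using arg_cong[OF sq, of "\<lambda>z. fst z $ 3"] arg_cong[OF sq, of "\<lambda>z. fst z $ 4"]
          by (elim disjE) (simp_all add: pt_def unit_coords_def)
      qed
      ultimately show ?thesis
        by simp
    qed
    show ?thesis
      using main[of k l] main[of k 1] main[of 1 l] by (cases "k = 0"; cases "l = 0") simp_all
  qed
  show ?thesis
  proof -
    have "L (frame_pt k l) = a 0 0 *\<^sub>R frame_pt k l" for k l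
      using A[of k l] unfolding eq[of k l] .
    then have "L z = frame_map (\<lambda>k l. a 0 0 *\<^sub>R frame_pt k l) z"
      using linear_eq_frame_map[OF L, of z] by (simp only:)
    also have "\<dots> = a 0 0 *\<^sub>R frame_map frame_pt z"
      by (simp add: frame_map_def algebra_simps)
    finally show ?thesis
      by (simp only: frame_map_frame_pt)
  qed
qed

lemma par_vert_V: "x \<in> par_ball \<Longrightarrow> par_vert x (V k l) = pt (unit_coords k) (unit_coords l)"
  by (simp add: par_vert_def E33_configuration.vert_def[OF E33_configuration_par])

text \<open>All members of the family share the vertices \<open>V k l\<close>, so
  \<open>frame_rigid\<close> makes the map a scalar and the remaining vertices agree, too.\<close>

lemma par_rigid:
  assumes x: "x \<in> par_ball" and y: "y \<in> par_ball"
    and eq: "labelled_equivalent id (par_vert x) (par_vert y)"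
  shows "x = y"
proof -
  obtain L g where L: "linear L" "\<And>k. 0 < g k"
    "\<And>k. L (par_vert x k, 1 :: real) = g k *\<^sub>R (par_vert y k, 1 :: real)"
    using eq by (rule labelled_equivalentE) (metis id_apply)
  have Lz: "L z = g (V 0 0) *\<^sub>R z" for z
    by (rule frame_rigid[OF L(1), of "\<lambda>k l. g (V k l)"]) (metis L(3) par_vert_V x y)
  have "g (V 0 0) *\<^sub>R (par_vert x k, 1 :: real) = g k *\<^sub>R (par_vert y k, 1 :: real)" for k
    using L(3)[of k] by (simp only: Lz)
  then have "g (V 0 0) *\<^sub>R par_vert x k = g k *\<^sub>R par_vert y k" "g (V 0 0) = g k" for k
    by simp_all
  then have "par_vert x k = par_vert y k" for k
    using L(2)[of k] by (metis less_irrefl scaleR_left_imp_eq)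
  then show ?thesis
    using x y by (intro par_vert_inject) auto
qed

text \<open>The last coordinate shows that the \<open>b j\<close> sum to \<open>c\<close>; dividing
  by \<open>c\<close> would put an extreme point in the hull of other vertices.\<close>

lemma extreme_not_positive_combination:
  fixes y :: "'k::finite \<Rightarrow> 'a::euclidean_space"
  assumes y: "inj y" "y k extreme_point_of convex hull (range y)"
    and c: "0 < c" and k: "k \<notin> S" and b: "\<And>j. j \<in> S \<Longrightarrow> 0 \<le> b j"
  shows "c *\<^sub>R (y k, 1 :: real) \<noteq> (\<Sum>j\<in>S. b j *\<^sub>R (y j, 1))"
proof
  assume "c *\<^sub>R (y k, 1 :: real) = (\<Sum>j\<in>S. b j *\<^sub>R (y j, 1))"
  then have eq: "c *\<^sub>R y k = (\<Sum>j\<in>S. b j *\<^sub>R y j)" "c = (\<Sum>j\<in>S. b j)"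
    by (auto simp: prod_eq_iff fst_sum snd_sum)
  have "y k = (1 / c) *\<^sub>R (\<Sum>j\<in>S. b j *\<^sub>R y j)"
    by (subst eq(1)[symmetric]) (use c in simp)
  also have "\<dots> = (\<Sum>j\<in>S. (b j / c) *\<^sub>R y j)"
    by (simp add: scaleR_sum_right)
  also have "\<dots> \<in> convex hull (y ` S)"
    using b c eq(2) by (intro convex_sum) (auto simp: hull_inc simp flip: sum_divide_distrib)
  finally have mem: "y k \<in> convex hull (y ` S)" .
  have "convex hull (y ` S) \<subseteq> convex hull (range y)"
    by (simp add: hull_mono image_mono)
  then have "y k extreme_point_of convex hull (y ` S)"
    using mem y(2) by (auto simp: extreme_point_of_def)
  then have "y k \<in> y ` S"
    by (rule extreme_point_of_convex_hull)
  then show False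
    using y(1) k by (auto dest: injD)
qed

text \<open>The slice of the range at height 1 is affine and contains a full-dimensional set of
  points, so it is everything.\<close>

lemma full_dimensional_surj:
  fixes y :: "'k \<Rightarrow> 'a::euclidean_space"
  assumes L: "linear L" and y: "aff_dim (convex hull (range y)) = DIM('a)"
    and mem: "\<And>k. (y k, 1 :: real) \<in> range L"
  shows "surj L"
proof -
  have sub: "subspace (range L)"
    using L by (simp add: linear_subspace_image)
  have "affine {q. (q, 1 :: real) \<in> range L}"
  proof -
    have "(u *\<^sub>R p + v *\<^sub>R q, 1 :: real) \<in> range L"
      if "(p, 1 :: real) \<in> range L" "(q, 1 :: real) \<in> range L" "u + v = 1" for p q u v
      using subspace_add[OF sub subspace_scale[OF sub that(1), of u] subspace_scale[OF sub that(2), of v]] that(3)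
      by simp
    then show ?thesis
      by (auto simp: affine_def)
  qed
  then have "affine hull (range y) \<subseteq> {q. (q, 1 :: real) \<in> range L}"
    using mem by (intro hull_minimal) auto
  moreover have "affine hull (range y) = UNIV"
    using y by (metis aff_dim_convex_hull aff_dim_eq_full)
  ultimately have one: "(q, 1 :: real) \<in> range L" for q
    by auto
  have "(q, s) \<in> range L" for q :: 'a and s :: real
    using subspace_add[OF sub subspace_diff[OF sub one[of q] one[of 0]] subspace_scale[OF sub one[of 0], of s]]
    by simp
  then show ?thesis
    by auto
qed

text \<open>Normalised maps and weights converge along a subsequence to a linear map
  \<open>K\<close> and weights \<open>a\<close>. What has to be excluded is degeneration: the
  weights are shown positive first at the product vertices, then at the outer ones, and finally
  \<open>K\<close> is shown bijective.\<close>

lemma labelled_equivalent_limit: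
  fixes ys :: "nat \<Rightarrow> real ^ 4 ^ 'n" and \<rho> :: "'n \<Rightarrow> E33_vertex"
  assumes xs: "\<And>n. xs n \<in> par_ball" "xs \<longlonglongrightarrow> x" and x: "x \<in> par_ball"
    and ys: "ys \<longlonglongrightarrow> y"
    and y: "inj (\<lambda>j. y $ j)" "\<And>j. y $ j extreme_point_of convex hull (range (\<lambda>j. y $ j))"
      "aff_dim (convex hull (range (\<lambda>j. y $ j))) = 4"
    and \<rho>: "bij \<rho>"
    and eq: "\<And>n. labelled_equivalent \<rho> (par_vert (xs n)) (\<lambda>j. ys n $ j)"
  shows "labelled_equivalent \<rho> (par_vert x) (\<lambda>j. y $ j)"
proof -
  have "\<exists>L g. linear L \<and> (\<forall>j. 0 < g j) \<and>
      (\<forall>j. L (par_vert (xs n) (\<rho> j), 1 :: real) = g j *\<^sub>R (ys n $ j, 1 :: real))" for n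
    using eq[of n] by (rule labelled_equivalentE) blast
  then obtain L g where L: "\<And>n. linear (L n)" and g: "\<And>n j. 0 < g n j"
    and Lg: "\<And>n j. L n (par_vert (xs n) (\<rho> j), 1 :: real) = g n j *\<^sub>R (ys n $ j, 1 :: real)"
    by metis
  \<comment> \<open>Weights of sum 1 stay in a compact cube, and not all of them can vanish in the
    limit.\<close>
  define G where "G n = (\<Sum>j\<in>UNIV. g n j)" for n
  have G: "0 < G n" for n
    unfolding G_def by (intro sum_pos g) auto
  define h :: "nat \<Rightarrow> real ^ 'n" where "h n = (\<chi> j. g n j / G n)" for n
  have gG: "g n j \<le> G n" for n j
    unfolding G_def by (rule member_le_sum) (use g in \<open>auto intro: less_imp_le\<close>)
  have "h n \<in> cbox 0 1" for n
    using g[of n] gG[of n] G[of n] by (auto simp: h_def mem_box_cart less_imp_le)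
  then obtain h0 r where r: "strict_mono r" "(h \<circ> r) \<longlonglongrightarrow> h0"
    using compact_cbox[of "0 :: real ^ 'n" 1] unfolding compact_def by metis
  have hr: "(\<lambda>n. h (r n) $ j) \<longlonglongrightarrow> h0 $ j" for j
    using r(2) by (auto simp: comp_def intro: tendsto_vec_nth)
  have h0: "0 \<le> h0 $ j" for j
    by (rule LIMSEQ_le_const[OF hr]) (use g G in \<open>auto simp: h_def less_imp_le\<close>)
  have h0_sum: "(\<Sum>j\<in>UNIV. h0 $ j) = 1"
  proof -
    have "(\<lambda>n. \<Sum>j\<in>UNIV. h (r n) $ j) \<longlonglongrightarrow> (\<Sum>j\<in>UNIV. h0 $ j)"
      by (intro tendsto_sum hr)
    moreover have "(\<Sum>j\<in>UNIV. h n $ j) = 1" for n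
      using G[of n] by (simp add: h_def G_def flip: sum_divide_distrib)
    ultimately show ?thesis
      by (simp add: LIMSEQ_const_iff)
  qed
  define M where "M n z = (1 / G n) *\<^sub>R L n z" for n z
  have M: "linear (M n)" for n
    unfolding M_def using L by (rule linear_compose_scale_right)
  have Mv: "M n (par_vert (xs n) k, 1) = h n $ inv \<rho> k *\<^sub>R (ys n $ inv \<rho> k, 1)" for n k
    using Lg[of n "inv \<rho> k"] \<rho> by (simp add: M_def h_def bij_is_surj surj_f_inv_f)
  define a where "a k = h0 $ inv \<rho> k" for k
  define Y where "Y k = y $ inv \<rho> k" for k
  have Y_range: "range Y = range (\<lambda>j. y $ j)"
    using bij_is_surj[OF bij_imp_bij_inv[OF \<rho>]] by (auto simp: Y_def image_iff) (metis surjD)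
  have Y: "inj Y" "\<And>k. Y k extreme_point_of convex hull (range Y)"
    using y(1,2) bij_is_inj[OF bij_imp_bij_inv[OF \<rho>]] unfolding Y_range by (auto simp: Y_def inj_def)
  \<comment> \<open>A linear map is determined by its frame values, so their convergence alone
    produces the limit map.\<close>
  define K where "K = frame_map (\<lambda>k l. a (V k l) *\<^sub>R (Y (V k l), 1 :: real))"
  have K: "linear K"
    unfolding K_def by (rule linear_frame_map)
  have Mlim: "(\<lambda>n. M (r n) (par_vert (xs (r n)) k, 1)) \<longlonglongrightarrow> a k *\<^sub>R (Y k, 1)" for k
    unfolding Mv a_def Y_def
    using LIMSEQ_subseq_LIMSEQ[OF ys r(1)]
    by (intro tendsto_scaleR hr tendsto_Pair tendsto_const tendsto_vec_nth) (simp add: comp_def)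
  have Kv: "K (par_vert x k, 1) = a k *\<^sub>R (Y k, 1)" for k
  proof -
    have "(\<lambda>n. par_vert (xs (r n)) k) \<longlonglongrightarrow> par_vert x k"
      using continuous_on_tendsto_compose[OF continuous_on_par_vert[of k] LIMSEQ_subseq_LIMSEQ[OF xs(2) r(1)] x] xs(1)
      by (simp add: comp_def)
    then have "(\<lambda>n. (par_vert (xs (r n)) k, 1 :: real)) \<longlonglongrightarrow> (par_vert x k, 1)"
      by (intro tendsto_Pair tendsto_const)
    moreover have "(\<lambda>n. M (r n) (frame_pt k l)) \<longlonglongrightarrow> a (V k l) *\<^sub>R (Y (V k l), 1)" for k l
      using Mlim[of "V k l"] xs(1) by (simp add: par_vert_V)
    ultimately have "(\<lambda>n. frame_map (\<lambda>k l. M (r n) (frame_pt k l)) (par_vert (xs (r n)) k, 1)) \<longlonglongrightarrow> K (par_vert x k, 1)"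
      unfolding K_def by (intro tendsto_frame_map)
    then have "(\<lambda>n. M (r n) (par_vert (xs (r n)) k, 1)) \<longlonglongrightarrow> K (par_vert x k, 1)"
      by (simp only: linear_eq_frame_map[OF M, symmetric])
    then show ?thesis
      using Mlim LIMSEQ_unique by blast
  qed
  have Kf: "K (frame_pt k l) = a (V k l) *\<^sub>R (Y (V k l), 1)" for k l
    using Kv[of "V k l"] x by (simp add: par_vert_V)
  have a0: "0 \<le> a k" for k
    by (simp add: a_def h0)
  have a_sum: "\<exists>k. a k \<noteq> 0"
  proof (rule ccontr)
    assume "\<not> ?thesis"
    then have "h0 $ j = 0" for j
      using a_def[of "\<rho> j"] \<rho> by (simp add: bij_is_inj)
    then show False
      using h0_sum by simp
  qed
  have square: "a (V k l) *\<^sub>R (Y (V k l), 1 :: real) + a (V k' l') *\<^sub>R (Y (V k' l'), 1) =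
      a (V k l') *\<^sub>R (Y (V k l'), 1) + a (V k' l) *\<^sub>R (Y (V k' l), 1)" for k l k' l'
    using frame_square[OF K, of k l k' l'] by (simp only: Kf)
  \<comment> \<open>If one corner of a parallelogram has weight 0, the opposite corner is a
    nonnegative combination of the other two. Extremality kills its weight, and the last coordinate
    then kills the other two. So all nine weights vanish, whence \<open>K\<close> and all of
    \<open>a\<close>.\<close>
  have aV: "0 < a (V k l)" for k l
  proof (rule ccontr)
    assume "\<not> ?thesis"
    then have z: "a (V k l) = 0"
      using a0[of "V k l"] by simp
    have step: "a (V k' l') = 0 \<and> a (V k l') = 0 \<and> a (V k' l) = 0" if "k' \<noteq> k" "l' \<noteq> l" for k' l'
    proof -
      have e: "a (V k' l') *\<^sub>R (Y (V k' l'), 1 :: real) = (\<Sum>j\<in>{V k l', V k' l}. a j *\<^sub>R (Y j, 1))"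
        using square[of k l k' l'] that by (simp add: z del: scaleR_Pair)
      then have z': "a (V k' l') = 0"
        using extreme_not_positive_combination[OF Y(1) Y(2)[of "V k' l'"], of "a (V k' l')" "{V k l', V k' l}" a]
          a0 that by (metis E33_vertex.inject(1) empty_iff insert_iff order_le_less)
      have "a (V k l') + a (V k' l) = 0"
        using arg_cong[OF e, of snd] z' that by simp
      then show ?thesis
        using z' a0[of "V k l'"] a0[of "V k' l"] by linarith
    qed
    have "k + 1 \<noteq> k" "l + 1 \<noteq> l"
      by simp_all
    then have "a (V k' l') = 0" for k' l'
      using step[of k' l'] step[of "k + 1" l'] step[of k' "l + 1"] z by (cases "k' = k"; cases "l' = l"; simp)
    then have "K q = 0" for q
      by (simp add: K_def frame_map_def zero_prod_def)
    then have "a k = 0" for k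
      using Kv[of k] by (simp add: prod_eq_iff)
    then show False
      using a_sum by simp
  qed
  \<comment> \<open>The segment from \<open>q\<close> to a product vertex passes through a point
    \<open>z\<close> of a face of the product that misses this vertex. If \<open>K\<close> killed
    \<open>(q, 1)\<close>, the image of \<open>z\<close> would be a positive multiple of an extreme
    lift and also a nonnegative combination of others.\<close>
  have visible: "K (q, 1) \<noteq> 0"
    if c: "0 < c" and z: "z = (1 - c) *\<^sub>R q + c *\<^sub>R pt (unit_coords k0) (unit_coords l0)"
      and lm: "\<And>k. 0 \<le> lam k z" "\<And>k. 0 \<le> mu k z" and z0: "lam k0 z = 0 \<or> mu l0 z = 0" for q c z k0 l0
  proof
    assume q: "K (q, 1) = 0"
    define S where "S = {V k l | k l. lam k z \<noteq> 0 \<and> mu l z \<noteq> 0}"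
    define H where "H = {p. \<exists>b. (\<forall>j\<in>S. 0 \<le> b j) \<and> K (p, 1) = (\<Sum>j\<in>S. b j *\<^sub>R (Y j, 1))}"
    have "convex H"
      unfolding convex_alt
    proof (intro ballI allI impI)
      fix p p' and u :: real
      assume "p \<in> H" "p' \<in> H" and u: "0 \<le> u \<and> u \<le> 1"
      then obtain b b' where b: "\<And>j. j \<in> S \<Longrightarrow> 0 \<le> b j" "K (p, 1) = (\<Sum>j\<in>S. b j *\<^sub>R (Y j, 1))"
        "\<And>j. j \<in> S \<Longrightarrow> 0 \<le> b' j" "K (p', 1) = (\<Sum>j\<in>S. b' j *\<^sub>R (Y j, 1))"
        by (auto simp: H_def)
      have "K ((1 - u) *\<^sub>R p + u *\<^sub>R p', 1) = K ((1 - u) *\<^sub>R (p, 1) + u *\<^sub>R (p', 1))"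
        by simp
      also have "\<dots> = (1 - u) *\<^sub>R K (p, 1) + u *\<^sub>R K (p', 1)"
        by (simp only: linear_add[OF K] linear_cmul[OF K])
      also have "\<dots> = (\<Sum>j\<in>S. ((1 - u) * b j + u * b' j) *\<^sub>R (Y j, 1))"
        by (simp only: b scaleR_sum_right sum.distrib[symmetric] scaleR_add_left scaleR_scaleR)
      finally show "(1 - u) *\<^sub>R p + u *\<^sub>R p' \<in> H"
        using b(1,3) u unfolding H_def
        by (intro CollectI exI[of _ "\<lambda>j. (1 - u) * b j + u * b' j"]) simp
    qed
    have "z \<in> H"
    proof (rule in_convex_hull_products[OF lm \<open>convex H\<close>])
      fix k l assume "lam k z \<noteq> 0" "mu l z \<noteq> 0"
      then have "V k l \<in> S"
        by (auto simp: S_def)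
      then have "(\<Sum>j\<in>S. (a j * of_bool (j = V k l)) *\<^sub>R (Y j, 1 :: real)) = a (V k l) *\<^sub>R (Y (V k l), 1)"
        by (subst sum.remove[of S "V k l"]) (auto simp: zero_prod_def[symmetric])
      then show "pt (unit_coords k) (unit_coords l) \<in> H"
        unfolding H_def using a0 Kf[of k l]
        by (intro CollectI exI[of _ "\<lambda>j. a j * of_bool (j = V k l)"]) simp
    qed
    then obtain b where b: "\<And>j. j \<in> S \<Longrightarrow> 0 \<le> b j" "K (z, 1) = (\<Sum>j\<in>S. b j *\<^sub>R (Y j, 1))"
      by (auto simp: H_def)
    have "(z, 1 :: real) = (1 - c) *\<^sub>R (q, 1) + c *\<^sub>R frame_pt k0 l0"
      by (simp add: z)
    then have "K (z, 1) = (1 - c) *\<^sub>R K (q, 1) + c *\<^sub>R K (frame_pt k0 l0)"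
      by (simp only: linear_add[OF K] linear_cmul[OF K])
    then have "K (z, 1) = (c * a (V k0 l0)) *\<^sub>R (Y (V k0 l0), 1)"
      by (simp only: q Kf scaleR_zero_right add_0_left scaleR_scaleR)
    then have "(c * a (V k0 l0)) *\<^sub>R (Y (V k0 l0), 1 :: real) = (\<Sum>j\<in>S. b j *\<^sub>R (Y j, 1))"
      using b(2) by (rule trans[OF sym])
    moreover have "V k0 l0 \<notin> S"
      using z0 by (auto simp: S_def)
    ultimately show False
      using extreme_not_positive_combination[OF Y(1) Y(2)[of "V k0 l0"], of "c * a (V k0 l0)" S b] b(1) c aV
      by simp
  qed
  interpret E33_configuration "par_t x" "par_tau x" "par_p x" "par_s x" "par_Q x" "par_R x"
    using x by (rule E33_configuration_par)
  have vert: "par_vert x = vert"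
    by (simp add: par_vert_def)
  \<comment> \<open>This \<open>c\<close> cancels the coordinate \<open>- p i\<close>: the segment
    from an outer vertex to a product vertex of index \<open>i - 1\<close> is cut where coordinate
    \<open>i - 1\<close> vanishes, as \<open>visible\<close> requires.\<close>
  have outer: "0 \<le> (1 - c) * circum t p i k + c * of_bool (k = i - 1)"
    "(1 - c) * circum t p i (i - 1) + c = 0"
    if "\<And>i. 0 < t i" "\<And>i. 0 < p i" "c = p i / (1 + p i)" for c t p i k
  proof -
    have c: "0 < 1 + p i" "1 - c = 1 / (1 + p i)"
      using that(2)[of i] by (simp_all add: that(3) field_simps)
    then show z: "(1 - c) * circum t p i (i - 1) + c = 0"
      by (simp add: circum_simps) (simp add: that(3))
    show "0 \<le> (1 - c) * circum t p i k + c * of_bool (k = i - 1)"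
    proof (cases "k = i - 1")
      case True
      then show ?thesis
        using z by simp
    next
      case False
      then have "0 < circum t p i k"
        using that(1,2) by (intro circum_pos)
      then show ?thesis
        using False c by simp
    qed
  qed
  have "K (vert k, 1) \<noteq> 0" for k
  proof (cases k)
    case (V i j)
    then show ?thesis
      using aV[of i j] Kv[of k] by (simp add: vert[symmetric] prod_eq_iff)
  next
    case (V1 i)
    define c where "c = par_p x i / (1 + par_p x i)"
    have c: "0 < c" "c < 1"
      using pos(3)[of i] by (simp_all add: c_def)
    define z where "z = (1 - c) *\<^sub>R vert (V1 i) + c *\<^sub>R vert (V (i - 1) 0)"
    have lm: "lam k z = (1 - c) * circum (par_t x) (par_p x) i k + c * of_bool (k = i - 1)"
      "mu k z = (1 - c) * par_Q x i (k + 1) + c * of_bool (k = 0)" for k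
      unfolding z_def lam_affine mu_affine lam_vert mu_vert by simp_all
    have "0 \<le> lam k z" "lam (i - 1) z = 0" for k
      using outer(1)[where t = "par_t x" and p = "par_p x" and c = c and i = i and k = k]
        outer(2)[where t = "par_t x" and p = "par_p x" and c = c and i = i] pos(1,3) by (simp_all add: lm c_def)
    moreover have "0 \<le> mu k z" for k
      using c pos(5)[of i "k + 1"] by (simp add: lm)
    ultimately show ?thesis
      using visible[OF c(1), of z "vert (V1 i)" "i - 1" 0] par_vert_V[OF x, of "i - 1" 0]
      by (simp add: V1 z_def vert)
  next
    case (V2 i)
    define c where "c = par_s x i / (1 + par_s x i)"
    have c: "0 < c" "c < 1"
      using pos(4)[of i] by (simp_all add: c_def)
    define z where "z = (1 - c) *\<^sub>R vert (V2 i) + c *\<^sub>R vert (V 0 (i - 1))"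
    have lm: "mu k z = (1 - c) * circum (par_tau x) (par_s x) i k + c * of_bool (k = i - 1)"
      "lam k z = (1 - c) * par_R x (k + 1) i + c * of_bool (k = 0)" for k
      unfolding z_def lam_affine mu_affine lam_vert mu_vert by simp_all
    have "0 \<le> mu k z" "mu (i - 1) z = 0" for k
      using outer(1)[where t = "par_tau x" and p = "par_s x" and c = c and i = i and k = k]
        outer(2)[where t = "par_tau x" and p = "par_s x" and c = c and i = i] pos(2,4) by (simp_all add: lm c_def)
    moreover have "0 \<le> lam k z" for k
      using c pos(6)[of "k + 1" i] by (simp add: lm)
    ultimately show ?thesis
      using visible[OF c(1), of z "vert (V2 i)" 0 "i - 1"] par_vert_V[OF x, of 0 "i - 1"]
      by (simp add: V2 z_def vert)
  qed
  then have a_pos: "0 < a k" for k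
    using Kv[of k] a0[of k] by (metis vert less_eq_real_def scaleR_zero_left)
  \<comment> \<open>The range contains the lifts of the vertices of a full-dimensional polytope,
    which restores bijectivity.\<close>
  have "(Y k, 1) \<in> range K" for k
  proof -
    have "K ((1 / a k) *\<^sub>R (par_vert x k, 1)) = (Y k, 1)"
      using Kv[of k] a_pos[of k] by (simp add: linear_cmul[OF K] del: scaleR_Pair)
    then show ?thesis
      by (metis rangeI)
  qed
  moreover have "aff_dim (convex hull (range Y)) = DIM(real ^ 4)"
    using y(3) by (simp add: Y_range)
  ultimately have "surj K"
    by (intro full_dimensional_surj[OF K, of Y])
  then have "bij K"
    using K linear_surjective_imp_injective by (auto simp: bij_def)
  show ?thesis
    unfolding labelled_equivalent_def
  proof (intro exI conjI allI)
    show "0 < a (\<rho> j)" for j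
      by (rule a_pos)
    show "K (par_vert x (\<rho> j), 1) = a (\<rho> j) *\<^sub>R (y $ j, 1)" for j
      using Kv[of "\<rho> j"] \<rho> by (simp add: Y_def bij_is_inj)
  qed (fact K, fact \<open>bij K\<close>)
qed

section \<open>Embedding a ball\<close>

abbreviation E33_realisations :: "(real ^ 4 ^ 15) set" where
  "E33_realisations \<equiv> realisation_space E33_face_lattice"

lemma E33_realisation:
  assumes "y \<in> E33_realisations"
  shows "inj (\<lambda>j. y $ j)" "y $ j extreme_point_of convex hull (range (\<lambda>j. y $ j))"
    "aff_dim (convex hull (range (\<lambda>j. y $ j))) = 4"
proof -
  have iso: "lattice_isomorphic (face_lattice (convex hull (range (\<lambda>j. y $ j)))) E33_face_lattice"
    using assms by (simp add: realisation_space_def)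
  have card: "CARD(E33_vertex) = CARD(15)"
    by (simp add: card_E33_vertex)
  show "inj (\<lambda>j. y $ j)" "y $ j extreme_point_of convex hull (range (\<lambda>j. y $ j))"
    by (rule lattice_isomorphic_points_extreme[OF iso empty_in_E33_face_lattice singleton_in_E33_face_lattice card])+
  have "aff_dim (convex hull (range (\<lambda>j. y $ j))) \<le> DIM(real ^ 4)"
    by (rule aff_dim_le_DIM)
  then show "aff_dim (convex hull (range (\<lambda>j. y $ j))) = 4"
    using E33_aff_dim[OF iso] by simp
qed

lemma closedin_sequentialI:
  fixes S :: "'a::metric_space set"
  assumes "S \<subseteq> T" "\<And>x l. (\<And>n. x n \<in> S) \<Longrightarrow> x \<longlonglongrightarrow> l \<Longrightarrow> l \<in> T \<Longrightarrow> l \<in> S"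
  shows "closedin (top_of_set T) S"
proof -
  have "T \<inter> closure S \<subseteq> S"
  proof
    fix l assume "l \<in> T \<inter> closure S"
    then obtain x where "\<And>n. x n \<in> S" "x \<longlonglongrightarrow> l" "l \<in> T"
      by (auto simp: closure_sequential)
    then show "l \<in> S"
      by (rule assms(2))
  qed
  then have "S = T \<inter> closure S"
    using assms(1) closure_subset by blast
  then show ?thesis
    by (metis closed_closure closedin_closed)
qed

text \<open>\<open>dim_le\<close> bounds the small inductive dimension, so dimension at least 9,
  infinity included, is the failure of the bound 8.\<close>

theorem theorem4p11:
  shows "\<not> (projective_realisation_space E33_face_lattice :: (real ^ 4 ^ 15) set topology) dim_le 8"
proof
  assume dim: "(projective_realisation_space E33_face_lattice :: (real ^ 4 ^ 15) set topology) dim_le 8"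
  obtain e :: "15 \<Rightarrow> E33_vertex" where e: "bij e"
    using finite_same_card_bij[of "UNIV :: 15 set" "UNIV :: E33_vertex set"] card_E33_vertex by auto
  define f :: "real ^ 3 ^ 3 \<Rightarrow> real ^ 4 ^ 15" where "f x = (\<chi> j. par_vert x (e j))" for x
  have range_f: "range (\<lambda>j. f x $ j) = range (par_vert x)" for x
    using bij_is_surj[OF e] by (simp add: f_def image_comp[symmetric, of _ e, unfolded comp_def])
  have f_mem: "f x \<in> E33_realisations" if "x \<in> par_ball" for x
    using E33_configuration.lattice_isomorphic_E33[OF E33_configuration_par[OF that]]
    by (simp add: realisation_space_def range_f par_vert_def)
  have cont_f: "continuous_on par_ball f"
    unfolding f_def by (intro continuous_on_vec_lambda continuous_on_par_vert)
  have lim: "labelled_equivalent \<rho> (par_vert x) (\<lambda>j. y $ j)"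
    if "\<And>n. xs n \<in> par_ball" "xs \<longlonglongrightarrow> x" "x \<in> par_ball" "ys \<longlonglongrightarrow> y" "y \<in> E33_realisations" "bij \<rho>"
      "\<And>n. labelled_equivalent \<rho> (par_vert (xs n)) (\<lambda>j. ys n $ j)" for \<rho> xs x ys y
    using that E33_realisation by (intro labelled_equivalent_limit[of xs x ys]) auto
  \<comment> \<open>The relabellings that identify \<open>f d\<close> with itself. Near a parameter
    \<open>d0\<close> with the fewest of them, none can appear, by the limit lemma, and none can
    disappear, by minimality.\<close>
  define \<Sigma> where "\<Sigma> d = {\<rho>. bij \<rho> \<and> labelled_equivalent \<rho> (par_vert d) (\<lambda>j. f d $ j)}" for d
  have "\<exists>d. d \<in> par_ball"
    unfolding par_ball_def using centre_in_ball by (metis zero_less_divide_1_iff zero_less_numeral)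
  then obtain d0 where d0: "d0 \<in> par_ball" "\<And>d. d \<in> par_ball \<Longrightarrow> card (\<Sigma> d0) \<le> card (\<Sigma> d)"
    using ex_has_least_nat[of "\<lambda>d. d \<in> par_ball" _ "\<lambda>d. card (\<Sigma> d)"] by auto
  \<comment> \<open>Otherwise one \<open>\<rho>\<close> identifies pairs of members tending to
    \<open>d0\<close>, and the limit lemma puts it into \<open>\<Sigma> d0\<close>. As there are
    finitely many \<open>\<rho>\<close>, one radius serves them all.\<close>
  have "\<exists>\<epsilon>>0. \<forall>c\<in>par_ball. \<forall>d\<in>par_ball. dist c d0 < \<epsilon> \<longrightarrow> dist d d0 < \<epsilon> \<longrightarrow> bij \<rho> \<longrightarrow>
      labelled_equivalent \<rho> (par_vert c) (\<lambda>j. f d $ j) \<longrightarrow> \<rho> \<in> \<Sigma> d0" for \<rho>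
  proof (rule ccontr)
    assume neg: "\<not> ?thesis"
    have "\<exists>c d. c \<in> par_ball \<and> d \<in> par_ball \<and> dist c d0 < inverse (real (Suc n)) \<and> dist d d0 < inverse (real (Suc n)) \<and> bij \<rho> \<and>
        labelled_equivalent \<rho> (par_vert c) (\<lambda>j. f d $ j) \<and> \<rho> \<notin> \<Sigma> d0" for n
      using neg[simplified, rule_format, of "inverse (real (Suc n))"] by auto
    then obtain c d where cd: "\<And>n. c n \<in> par_ball" "\<And>n. d n \<in> par_ball"
      "\<And>n. dist (c n) d0 < inverse (real (Suc n))" "\<And>n. dist (d n) d0 < inverse (real (Suc n))"
      "\<And>n. labelled_equivalent \<rho> (par_vert (c n)) (\<lambda>j. f (d n) $ j)" "bij \<rho>" "\<rho> \<notin> \<Sigma> d0"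
      by metis
    have to_d0: "s \<longlonglongrightarrow> d0" if "\<And>n. dist (s n) d0 < inverse (real (Suc n))" for s
    proof (rule metric_tendsto_imp_tendsto[of "\<lambda>n. inverse (real (Suc n))" 0])
      show "\<forall>\<^sub>F n in sequentially. dist (s n) d0 \<le> dist (inverse (real (Suc n))) 0"
        using that by (intro always_eventually) (auto simp: less_imp_le)
    qed (rule LIMSEQ_inverse_real_of_nat)
    have "(\<lambda>n. f (d n)) \<longlonglongrightarrow> f d0"
      using continuous_on_tendsto_compose[OF cont_f to_d0[OF cd(4)] d0(1)] cd(2) by simp
    then have "labelled_equivalent \<rho> (par_vert d0) (\<lambda>j. f d0 $ j)"
      by (rule lim[OF cd(1) to_d0[OF cd(3)] d0(1) _ f_mem[OF d0(1)] cd(6) cd(5)])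
    then show False
      using cd(6,7) by (simp add: \<Sigma>_def)
  qed
  then obtain \<epsilon> where \<epsilon>: "\<And>\<rho>. 0 < \<epsilon> \<rho>"
    "\<And>\<rho> c d. c \<in> par_ball \<Longrightarrow> d \<in> par_ball \<Longrightarrow> dist c d0 < \<epsilon> \<rho> \<Longrightarrow> dist d d0 < \<epsilon> \<rho> \<Longrightarrow> bij \<rho> \<Longrightarrow>
      labelled_equivalent \<rho> (par_vert c) (\<lambda>j. f d $ j) \<Longrightarrow> \<rho> \<in> \<Sigma> d0"
    by metis
  obtain \<delta> where \<delta>: "0 < \<delta>" "cball d0 \<delta> \<subseteq> par_ball" "\<And>\<rho>. \<delta> < \<epsilon> \<rho>"
  proof -
    have "open par_ball"
      by (simp add: par_ball_def)
    then obtain \<delta>0 where \<delta>0: "0 < \<delta>0" "cball d0 \<delta>0 \<subseteq> par_ball"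
      using d0(1) open_contains_cball by blast
    define m where "m = Min (range \<epsilon>)"
    have m: "0 < m" "\<And>\<rho>. m \<le> \<epsilon> \<rho>"
      using \<epsilon>(1) by (auto simp: m_def)
    have "min \<delta>0 (m / 2) < \<epsilon> \<rho>" for \<rho>
      using m(1) m(2)[of \<rho>] by linarith
    moreover have "cball d0 (min \<delta>0 (m / 2)) \<subseteq> par_ball"
      using \<delta>0(2) by auto
    ultimately show thesis
      using \<delta>0(1) m(1) by (intro that[of "min \<delta>0 (m / 2)"]) auto
  qed
  define D where "D = cball d0 \<delta>"
  have D: "d \<in> par_ball" "dist d d0 < \<epsilon> \<rho>" if "d \<in> D" for d \<rho>
    using that \<delta>(2) \<delta>(3)[of \<rho>] by (auto simp: D_def dist_commute)
  have \<Sigma>_eq: "\<Sigma> d = \<Sigma> d0" if "d \<in> D" for d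
  proof -
    have "\<Sigma> d \<subseteq> \<Sigma> d0"
      using \<epsilon>(2) D[OF that] by (auto simp: \<Sigma>_def[of d])
    then show ?thesis
      using d0(2)[OF D(1)[OF that]] by (simp add: card_seteq)
  qed

  \<comment> \<open>The quotient map on a ball around \<open>d0\<close>\<close>
  define r where "r = (projective_equivalence E33_face_lattice :: ((real ^ 4 ^ 15) \<times> (real ^ 4 ^ 15)) set)"
  have equiv_r: "equiv E33_realisations r"
    unfolding r_def by (rule equiv_projective_equivalence)
  have r_iff: "(f c, y) \<in> r \<longleftrightarrow>
      (\<exists>\<rho>. bij \<rho> \<and> labelled_equivalent \<rho> (par_vert c) (\<lambda>j. y $ j))"
    if "c \<in> par_ball" "y \<in> E33_realisations" for c y
  proof
    assume "(f c, y) \<in> r"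
    then have "projectively_equivalent (convex hull (range (par_vert c))) (convex hull (range (\<lambda>j. y $ j)))"
      by (simp add: r_def projective_equivalence_def range_f)
    then show "\<exists>\<rho>. bij \<rho> \<and> labelled_equivalent \<rho> (par_vert c) (\<lambda>j. y $ j)"
      using E33_realisation[OF that(2)] card_E33_vertex
      by (elim labelled_if_projectively_equivalent) auto
  next
    assume "\<exists>\<rho>. bij \<rho> \<and> labelled_equivalent \<rho> (par_vert c) (\<lambda>j. y $ j)"
    then show "(f c, y) \<in> r"
      using projectively_equivalent_if_labelled that f_mem
      by (auto simp: r_def projective_equivalence_def range_f)
  qed
  define g where "g x = r `` {f x}" for x
  have g_eq: "r `` {y} = g c \<longleftrightarrow> (f c, y) \<in> r" if "c \<in> par_ball" "y \<in> E33_realisations" for c y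
    using eq_equiv_class_iff[OF equiv_r f_mem[OF that(1)] that(2)] by (auto simp: g_def)
  define Q where "Q = quotient_topology (top_of_set E33_realisations) r"
  \<comment> \<open>A relabelling that identifies \<open>c\<close> with \<open>d\<close> lies in
    \<open>\<Sigma> d0\<close>, which is \<open>\<Sigma> d\<close>, so it identifies
    \<open>d\<close> with itself as well. Cancelling it leaves a labelled equivalence of
    \<open>c\<close> and \<open>d\<close>, and rigidity applies.\<close>
  have "inj_on g D"
  proof (rule inj_onI)
    fix c d assume c: "c \<in> D" and d: "d \<in> D" and "g c = g d"
    then have "(f c, f d) \<in> r"
      using g_eq[of c "f d"] f_mem D(1) by (simp add: g_def)
    then obtain \<rho> where \<rho>: "bij \<rho>" "labelled_equivalent \<rho> (par_vert c) (\<lambda>j. f d $ j)"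
      using r_iff[of c "f d"] f_mem D(1) c d by auto
    then have "\<rho> \<in> \<Sigma> d"
      using \<epsilon>(2)[of c d \<rho>] D[OF c] D[OF d] \<Sigma>_eq[OF d] by simp
    then have "labelled_equivalent id (par_vert c) (par_vert d)"
      using labelled_equivalent_left_unique[OF \<rho>(2) _ \<rho>(1)] by (simp add: \<Sigma>_def)
    then show "c = d"
      using par_rigid D(1) c d by blast
  qed
  moreover have "continuous_map (top_of_set D) Q g"
  proof -
    have "continuous_map (top_of_set D) (top_of_set E33_realisations) f"
      using continuous_on_subset[OF cont_f, of D] f_mem D(1)
      by (auto simp: continuous_map_in_subtopology)
    moreover have "continuous_map (top_of_set E33_realisations) Q (\<lambda>x. r `` {x})"
      unfolding Q_def by (rule quotient_imp_continuous_map[OF quotient_map_quotient_topology])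
    ultimately have "continuous_map (top_of_set D) Q ((\<lambda>x. r `` {x}) \<circ> f)"
      by (rule continuous_map_compose)
    then show ?thesis
      by (simp add: g_def[abs_def] comp_def)
  qed
  moreover have "closed_map (top_of_set D) Q g"
    unfolding closed_map_def
  proof (intro allI impI)
    fix C assume C: "closedin (top_of_set D) C"
    then have "compact C" "C \<subseteq> D"
      using closedin_compact[of D C] closedin_subset[OF C] by (auto simp: D_def)
    have Cp: "c \<in> par_ball" if "c \<in> C" for c
      using D(1) \<open>C \<subseteq> D\<close> that by blast
    \<comment> \<open>The realisations equivalent to a member over \<open>C\<close> form the union
      of these finitely many sets. Each is closed, by compactness of \<open>C\<close> and the limit
      lemma.\<close>
    define S where "S \<rho> = {y \<in> E33_realisations. bij \<rho> \<and> (\<exists>c\<in>C. labelled_equivalent \<rho> (par_vert c) (\<lambda>j. y $ j))}" for \<rho>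
    have "closedin (top_of_set E33_realisations) (S \<rho>)" for \<rho>
    proof (rule closedin_sequentialI)
      fix ys y assume ys: "\<And>n. ys n \<in> S \<rho>" "ys \<longlonglongrightarrow> y" and y: "y \<in> E33_realisations"
      then have "bij \<rho>" "\<exists>c. c \<in> C \<and> labelled_equivalent \<rho> (par_vert c) (\<lambda>j. ys n $ j)" for n
        by (auto simp: S_def)
      then obtain cs where cs: "\<And>n. cs n \<in> C" "\<And>n. labelled_equivalent \<rho> (par_vert (cs n)) (\<lambda>j. ys n $ j)"
        by metis
      obtain c k where k: "c \<in> C" "strict_mono k" "(cs \<circ> k) \<longlonglongrightarrow> c"
        using \<open>compact C\<close> cs(1) unfolding compact_def by metis
      have "labelled_equivalent \<rho> (par_vert c) (\<lambda>j. y $ j)"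
        by (rule lim[of "cs \<circ> k" c "ys \<circ> k"])
          (use k cs Cp ys(2) y \<open>bij \<rho>\<close> LIMSEQ_subseq_LIMSEQ in auto)
      then show "y \<in> S \<rho>"
        using k(1) y \<open>bij \<rho>\<close> by (auto simp: S_def)
    qed (auto simp: S_def)
    then have "closedin (top_of_set E33_realisations) (\<Union>\<rho>. S \<rho>)"
      by (intro closedin_Union) auto
    moreover have "{y \<in> E33_realisations. r `` {y} \<in> g ` C} = (\<Union>\<rho>. S \<rho>)"
    proof -
      have mem: "r `` {y} \<in> g ` C \<longleftrightarrow> (\<exists>\<rho>. y \<in> S \<rho>)" if y: "y \<in> E33_realisations" for y
      proof -
        have "r `` {y} \<in> g ` C \<longleftrightarrow> (\<exists>c\<in>C. \<exists>\<rho>. bij \<rho> \<and> labelled_equivalent \<rho> (par_vert c) (\<lambda>j. y $ j))"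
          using g_eq[OF Cp y] r_iff[OF Cp y] by (simp add: image_iff)
        then show ?thesis
          using y unfolding S_def by blast
      qed
      have "{y \<in> E33_realisations. r `` {y} \<in> g ` C} = {y \<in> E33_realisations. \<exists>\<rho>. y \<in> S \<rho>}"
        by (intro Collect_cong conj_cong refl mem)
      also have "\<dots> = (\<Union>\<rho>. S \<rho>)"
        unfolding S_def by blast
      finally show ?thesis .
    qed
    ultimately have "closedin (top_of_set E33_realisations) {y \<in> E33_realisations. r `` {y} \<in> g ` C}"
      by simp
    moreover have "{y \<in> E33_realisations. r `` {y} \<in> E33_realisations // r - g ` C} =
        E33_realisations - {y \<in> E33_realisations. r `` {y} \<in> g ` C}"
      using quotientI[of _ E33_realisations r] by blast
    moreover have "g ` C \<subseteq> E33_realisations // r"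
      unfolding g_def by (intro image_subsetI quotientI f_mem Cp)
    ultimately show "closedin Q (g ` C)"
      by (simp add: Q_def closedin_def topspace_quotient_topology openin_quotient_topology)
  qed
  ultimately have "embedding_map (top_of_set D) Q g"
    by (intro injective_closed_imp_embedding_map) auto
  then have "top_of_set D homeomorphic_space subtopology Q (g ` D)"
    using embedding_map_imp_homeomorphic_space by fastforce
  moreover have "subtopology Q (g ` D) dim_le 8"
    using dim unfolding Q_def r_def projective_realisation_space_def by (rule dimension_le_subtopology)
  ultimately have "top_of_set D dim_le 8"
    using homeomorphic_space_dimension_le by blast
  \<comment> \<open>\<open>real ^ 3 ^ 3\<close> has dimension 9, so the bound excluded for the ball
    is \<open>9 - 1\<close>.\<close>
  then show False
    using cball_not_dimension_le[OF \<delta>(1), of d0] by (simp add: D_def)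
qed

end
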